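(* Let $R,S,I_1,I_2$ be mutually independent random variables, where $R$ is almost surely positive with distribution function $F$ (so $F(0-)=0$), $S$ takes values in $(0,1)$ and has a distribution function $G$ possessing a continuous density function $g$, and $I_1,I_2$ take the values $-1,1$ with probability $1/2$ each. Let $(U_1,U_2)$ be a random vector with $(U_1,U_2)\overset{d}{=}R\,(I_1S,\,I_2\sqrt{1-S^2})$, and for $\rho\in(0,1)$ let $U(\rho)=\rho U_1+\sqrt{1-\rho^2}\,U_2$. Suppose that $F\in\mathrm{MDA}(\Lambda,w)$ with $r_F\in(0,\infty]$. Then $$\mathbf P\{U(\rho)>u\}\sim\mathbf P\{U_1>u\},\qquad u\uparrow r_F,$$ holds for all $\rho\in(0,1)$ if and only if $(U_1,U_2)$ is spherical. Similarly, denoting by $h_\rho$ the density function of $U(\rho)$ and by $h_1$ that of $U_1$, $$h_\rho(u)\sim h_1(u),\qquad u\uparrow r_F,$$ holds for all $\rho\in(0,1)$ if and only if $(U_1,U_2)$ is spherical.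
   Context: $\overline F=1-F$, $r_F=\sup\{x:F(x)<1\}$; $a(u)\sim b(u)$ means $a(u)/b(u)\to1$ in the indicated limit; $\overset{d}{=}$ is equality in distribution. $(U_1,U_2)$ is called spherical if it is a spherically distributed random vector, i.e. its distribution is invariant under orthogonal transformations of $\mathbb R^2$. The density $g$ is continuous on $(0,1)$. $F\in\mathrm{MDA}(\Lambda,w)$ (Gumbel max-domain of attraction with scaling function $w$) means that $w$ is a positive function with $\lim_{u\uparrow r_F}\overline F(u+x/w(u))/\overline F(u)=e^{-x}$ for all $x\in\mathbb R$, and $\lim_{u\uparrow r_F}u\,w(u)=\infty$, and, if $r_F<\infty$, $\lim_{u\uparrow r_F}w(u)(r_F-u)=\infty$.
   Formalization: Since densities are determined only up to null sets, h_ρ(u) ~ h_1(u) is taken as a limit modulo Lebesgue null sets, for arbitrary versions of the densities; for continuous nonvanishing versions this is the usual pointwise limit. *)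

theory Defs
  imports "HOL-Probability.Probability"
begin

definition right_endpoint :: "(real \<Rightarrow> real) \<Rightarrow> ereal" where
  "right_endpoint F = (SUP x\<in>{x. F x < 1}. ereal x)"

text \<open>The filter for a real variable \<open>u\<close> increasing to \<open>r\<close>, where \<open>r\<close> is real or \<open>\<infinity>\<close>.\<close>

definition increasing_to :: "ereal \<Rightarrow> real filter" where
  "increasing_to r = (if r = \<infinity> then at_top else at_left (real_of_ereal r))"

text \<open>Positivity of \<open>w\<close> is only required on \<open>(0, r\<^sub>F)\<close>, so that common choices such as
  \<open>w u = u\<close> or \<open>w u = 1 / (r\<^sub>F - u) ^ 3\<close> need no redefinition elsewhere.\<close>

definition MDA_Gumbel :: "(real \<Rightarrow> real) \<Rightarrow> (real \<Rightarrow> real) \<Rightarrow> bool" where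
  "MDA_Gumbel F w \<longleftrightarrow>
     (\<forall>u. 0 < u \<and> ereal u < right_endpoint F \<longrightarrow> 0 < w u) \<and>
     (\<forall>x. ((\<lambda>u. (1 - F (u + x / w u)) / (1 - F u)) \<longlongrightarrow> exp (- x))
            (increasing_to (right_endpoint F))) \<and>
     filterlim (\<lambda>u. u * w u) at_top (increasing_to (right_endpoint F)) \<and>
     (right_endpoint F < \<infinity> \<longrightarrow>
        filterlim (\<lambda>u. w u * (real_of_ereal (right_endpoint F) - u)) at_top
          (increasing_to (right_endpoint F)))"

definition has_real_density :: "'a measure \<Rightarrow> ('a \<Rightarrow> real) \<Rightarrow> (real \<Rightarrow> real) \<Rightarrow> bool" where
  "has_real_density M X f \<longleftrightarrow>
     (\<forall>x. 0 \<le> f x) \<and> distributed M lborel X (\<lambda>x. ennreal (f x))"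

definition spherical :: "'a measure \<Rightarrow> ('a \<Rightarrow> real \<times> real) \<Rightarrow> bool" where
  "spherical M X \<longleftrightarrow>
     (\<forall>T. orthogonal_transformation T \<longrightarrow>
        distr M borel (\<lambda>\<omega>. T (X \<omega>)) = distr M borel X)"

definition combination :: "('a \<Rightarrow> real) \<Rightarrow> ('a \<Rightarrow> real) \<Rightarrow> real \<Rightarrow> 'a \<Rightarrow> real" where
  "combination U\<^sub>1 U\<^sub>2 \<rho> \<omega> = \<rho> * U\<^sub>1 \<omega> + sqrt (1 - \<rho>\<^sup>2) * U\<^sub>2 \<omega>"

definition tail_equiv :: "ereal \<Rightarrow> (real \<Rightarrow> real) \<Rightarrow> (real \<Rightarrow> real) \<Rightarrow> bool" where
  "tail_equiv r a b \<longleftrightarrow> ((\<lambda>u. a u / b u) \<longlongrightarrow> 1) (increasing_to r)"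

text \<open>
  Densities are determined only up to Lebesgue null sets (and the densities considered here need
  not have continuous or even locally bounded versions), so the asymptotic equivalence of two
  densities is the same limit of the quotient taken modulo null sets: for every \<open>e > 0\<close> there is
  \<open>u\<^sub>0 < r\<close> with \<open>\<bar>a u / b u - 1\<bar> < e\<close> for almost every \<open>u\<close> in \<open>(u\<^sub>0, r)\<close>. It does not depend on
  the versions chosen, is implied by \<^const>\<open>tail_equiv\<close>, and coincides with it if \<open>a\<close> and \<open>b\<close> are
  continuous and \<open>b\<close> has no zeros to the left of \<open>r\<close>.
\<close>

definition density_tail_equiv :: "ereal \<Rightarrow> (real \<Rightarrow> real) \<Rightarrow> (real \<Rightarrow> real) \<Rightarrow> bool" where
  "density_tail_equiv r a b \<longleftrightarrow>
     ((\<lambda>u. a u / b u) \<longlongrightarrow> 1) (inf (increasing_to r) (ae_filter lborel))"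

end

theory Submission imports Defs begin

text \<open>
  Write the vector as \<open>(U\<^sub>1, U\<^sub>2) = R (sin \<phi>, cos \<phi>)\<close> with an angle \<open>\<phi>\<close> independent of \<open>R\<close>. The signs
  and the density \<open>g\<close> of \<open>S\<close> give \<open>\<phi>\<close> the density \<open>q(\<phi>) = g(\<bar>sin \<phi>\<bar>) \<bar>cos \<phi>\<bar> / 4\<close> on \<open>(0, 2\<pi>)\<close>
  (\<open>law_signed_polar\<close>). With \<open>\<rho> = sin \<alpha>\<close> the combination \<open>U(\<rho>)\<close> becomes \<open>R cos(\<phi> - \<alpha>)\<close>, and \<open>U\<^sub>1\<close> is the
  case \<open>\<alpha> = \<pi>/2\<close>; the vector is spherical as soon as \<open>q\<close> is almost everywhere constant
  (\<open>distr_law_orthogonal\<close>).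

  Membership in the Gumbel domain of attraction makes the tail \<open>T\<close> of \<open>R\<close> rapidly varying
  (\<open>MDA_Gumbel_rapid_variation\<close>). Hence \<open>R cos(\<phi> - \<alpha>)\<close> is close to the right endpoint only if \<open>\<phi>\<close> is close to
  \<open>\<alpha>\<close>: for small \<open>\<delta>\<close> the tail \<open>P(R cos(\<phi> - \<alpha>) > u)\<close> is comparable, up to \<open>T(u / cos \<delta>)\<close>, with
  \<open>q(\<alpha>)\<close> times the integral of \<open>T(u / cos t)\<close> over \<open>\<bar>t\<bar> < \<delta>\<close>, and the error is negligible. That integral
  does not depend on \<open>\<alpha>\<close>. So if the tails in two directions \<open>\<alpha>, \<beta> \<in> (0, \<pi>/2)\<close> are equivalent,
  then \<open>q(\<alpha>) = q(\<beta>)\<close> (\<open>angular_density_mono_of_ratio\<close>). Equivalence of every \<open>U(\<rho>)\<close> with \<open>U\<^sub>1\<close> therefore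
  forces \<open>q\<close> to be constant on \<open>(0, \<pi>/2)\<close>, by symmetry almost everywhere on the circle. In this argument
  \<open>U\<^sub>1\<close> is a common yardstick for the other directions, however \<open>g\<close> behaves near \<open>1\<close>.

  Conversely, for a spherical vector all \<open>U(\<rho>)\<close> have the law of \<open>U\<^sub>1\<close>, and the quotient of two tails is
  \<open>1\<close> wherever they do not vanish.

  Equivalent densities have equivalent integrals (\<open>tail_equiv_of_density_tail_equiv\<close>), which reduces one
  direction of the statement on densities to that on tails. In the other direction the densities agree almost
  everywhere, and what remains is that the density of \<open>U\<^sub>1\<close> is positive almost everywhere between \<open>0\<close> and the
  right endpoint (\<open>AE_first_density_pos\<close>): the angle being uniform, for almost every radius \<open>r\<close> a Borel set
  that \<open>U\<^sub>1\<close> avoids is missed by \<open>r sin \<phi>\<close> for almost all \<open>\<phi>\<close>, so its part in \<open>(0, r)\<close> is a null set.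
\<close>

section \<open>Integrals over intervals\<close>

lemma nn_integral_Ioo_Icc:
  fixes H :: "real \<Rightarrow> ennreal"
  shows "(\<integral>\<^sup>+x\<in>{a<..<b}. H x \<partial>lborel) = (\<integral>\<^sup>+x\<in>{a..b}. H x \<partial>lborel)"
  by (rule nn_integral_cong_AE)
     (use AE_lborel_singleton[of a] AE_lborel_singleton[of b] in eventually_elim, auto simp: indicator_def)

lemma nn_integral_Ioo_split:
  fixes H :: "real \<Rightarrow> ennreal"
  assumes [measurable]: "H \<in> borel_measurable borel" and "a \<le> b" "b \<le> c"
  shows "(\<integral>\<^sup>+x\<in>{a<..<c}. H x \<partial>lborel) = (\<integral>\<^sup>+x\<in>{a<..<b}. H x \<partial>lborel) + (\<integral>\<^sup>+x\<in>{b<..<c}. H x \<partial>lborel)"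
proof -
  have "(\<integral>\<^sup>+x\<in>{a<..<c}. H x \<partial>lborel)
      = (\<integral>\<^sup>+x. H x * indicator {a<..<b} x + H x * indicator {b<..<c} x \<partial>lborel)"
    by (rule nn_integral_cong_AE)
       (use AE_lborel_singleton[of b] in eventually_elim, use assms in \<open>auto simp: indicator_def\<close>)
  then show ?thesis by (simp add: nn_integral_add)
qed

lemma nn_integral_Ioo_shift:
  fixes H :: "real \<Rightarrow> ennreal"
  assumes [measurable]: "H \<in> borel_measurable borel"
  shows "(\<integral>\<^sup>+x\<in>{a<..<b}. H x \<partial>lborel) = (\<integral>\<^sup>+x\<in>{a-t<..<b-t}. H (x + t) \<partial>lborel)"
  by (subst nn_integral_real_affine[where c=1 and t=t])
     (auto intro!: nn_integral_cong simp: indicator_def add.commute)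

lemma nn_integral_Ioo_reflect:
  fixes H :: "real \<Rightarrow> ennreal"
  assumes [measurable]: "H \<in> borel_measurable borel"
  shows "(\<integral>\<^sup>+x\<in>{a<..<b}. H x \<partial>lborel) = (\<integral>\<^sup>+x\<in>{t-b<..<t-a}. H (t - x) \<partial>lborel)"
  by (subst nn_integral_real_affine[where c="-1" and t=t])
     (auto intro!: nn_integral_cong simp: indicator_def)

text \<open>
  Two foldings, at \<open>\<pi>\<close> and at \<open>\<pi>/2\<close>, bring the four quadrants of the circle back to the first one.
\<close>

lemma nn_integral_Ioo_fold:
  fixes H :: "real \<Rightarrow> ennreal"
  assumes [measurable]: "H \<in> borel_measurable borel" and "0 \<le> c"
  shows "(\<integral>\<^sup>+x\<in>{0<..<2*c}. H x \<partial>lborel) = (\<integral>\<^sup>+x\<in>{0<..<c}. (H x + H (2*c - x)) \<partial>lborel)"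
proof -
  have "(\<integral>\<^sup>+x\<in>{c<..<2*c}. H x \<partial>lborel) = (\<integral>\<^sup>+x\<in>{0<..<c}. H (2*c - x) \<partial>lborel)"
    by (subst nn_integral_Ioo_reflect[where t="2*c"]) auto
  then show ?thesis
    using assms by (subst nn_integral_Ioo_split[where b=c]) (auto simp: nn_integral_add distrib_right)
qed

lemma nn_integral_sin_substitution:
  fixes H :: "real \<Rightarrow> ennreal"
  assumes [measurable]: "H \<in> borel_measurable borel"
  shows "(\<integral>\<^sup>+s\<in>{0<..<1}. H s \<partial>lborel) = (\<integral>\<^sup>+x\<in>{0<..<pi/2}. H (sin x) * ennreal (cos x) \<partial>lborel)"
proof -
  have "(\<integral>\<^sup>+s. H s * indicator {sin 0..sin (pi/2)} s \<partial>lborel)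
      = (\<integral>\<^sup>+x. H (sin x) * ennreal (cos x) * indicator {0..pi/2} x \<partial>lborel)"
    by (rule nn_integral_substitution_aux)
       (auto intro!: derivative_eq_intros continuous_intros cos_ge_zero)
  then show ?thesis unfolding nn_integral_Ioo_Icc by simp
qed

lemma nn_integral_periodic:
  fixes H :: "real \<Rightarrow> ennreal"
  assumes [measurable]: "H \<in> borel_measurable borel" and per: "\<And>x. H (x + p) = H x"
    and t: "0 \<le> t" "t \<le> p"
  shows "(\<integral>\<^sup>+x\<in>{t<..<t + p}. H x \<partial>lborel) = (\<integral>\<^sup>+x\<in>{0<..<p}. H x \<partial>lborel)"
proof -
  have "(\<integral>\<^sup>+x\<in>{p<..<t + p}. H x \<partial>lborel) = (\<integral>\<^sup>+x\<in>{0<..<t}. H x \<partial>lborel)"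
    by (subst nn_integral_Ioo_shift[where t=p]) (auto simp: per)
  then show ?thesis
    using t nn_integral_Ioo_split[of H t p "t + p"] nn_integral_Ioo_split[of H 0 t p]
    by (simp add: add.commute)
qed

section \<open>Independent signs and the angle\<close>

lemma nn_integral_sign:
  fixes X :: "'a \<Rightarrow> real"
  assumes "prob_space M" and [measurable]: "X \<in> borel_measurable M"
    and p: "measure M {\<omega> \<in> space M. X \<omega> = 1} = 1 / 2" "measure M {\<omega> \<in> space M. X \<omega> = -1} = 1 / 2"
    and [measurable]: "f \<in> borel_measurable borel"
  shows "(\<integral>\<^sup>+x. f x \<partial>distr M borel X) = (f 1 + f (-1)) / 2"
proof -
  interpret prob_space M by fact
  have "prob ({\<omega> \<in> space M. X \<omega> = 1} \<union> {\<omega> \<in> space M. X \<omega> = -1}) = 1"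
    by (subst finite_measure_Union) (auto simp: p)
  then have "AE \<omega> in M. \<omega> \<in> {\<omega> \<in> space M. X \<omega> = 1} \<union> {\<omega> \<in> space M. X \<omega> = -1}"
    by (subst AE_in_set_eq_1) auto
  then have "(\<integral>\<^sup>+\<omega>. f (X \<omega>) \<partial>M) = (\<integral>\<^sup>+\<omega>. f 1 * indicator {\<omega> \<in> space M. X \<omega> = 1} \<omega> + f (-1) * indicator {\<omega> \<in> space M. X \<omega> = -1} \<omega> \<partial>M)"
    by (intro nn_integral_cong_AE) (auto simp: indicator_def)
  also have "\<dots> = f 1 * ennreal (1/2) + f (-1) * ennreal (1/2)"
    by (simp add: nn_integral_add nn_integral_cmult emeasure_eq_measure p)
  also have "\<dots> = (f 1 + f (-1)) / 2"
    by (simp add: divide_ennreal_def ennreal_divide_numeral[symmetric] distrib_right inverse_ennreal[symmetric] flip: ennreal_numeral)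
  finally show ?thesis by (simp add: nn_integral_distr)
qed

text \<open>
  Independence makes the joint law of the four variables a product measure, over which one
  variable is integrated at a time.
\<close>

lemma nn_integral_four_indep:
  fixes R S I1 I2 :: "'a \<Rightarrow> real" and f :: "real \<Rightarrow> real \<Rightarrow> real \<Rightarrow> real \<Rightarrow> ennreal"
  assumes "prob_space M" and indep: "prob_space.indep_vars M (\<lambda>_. borel) (\<lambda>i. [R, S, I1, I2] ! i) {..<4}"
    and f: "(\<lambda>(r, s, a, b). f r s a b) \<in> borel_measurable (borel \<Otimes>\<^sub>M borel \<Otimes>\<^sub>M borel \<Otimes>\<^sub>M borel)"
  shows "(\<integral>\<^sup>+\<omega>. f (R \<omega>) (S \<omega>) (I1 \<omega>) (I2 \<omega>) \<partial>M) =
    (\<integral>\<^sup>+r. \<integral>\<^sup>+s. \<integral>\<^sup>+a. \<integral>\<^sup>+b. f r s a b \<partial>distr M borel I2 \<partial>distr M borel I1 \<partial>distr M borel S \<partial>distr M borel R)"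
proof -
  interpret prob_space M by fact
  let ?X = "\<lambda>i. [R, S, I1, I2] ! i"
  have rv: "\<And>i. i \<in> {..<4} \<Longrightarrow> random_variable borel (?X i)"
    using indep unfolding indep_vars_def by auto
  have [measurable]: "R \<in> borel_measurable M" "S \<in> borel_measurable M" "I1 \<in> borel_measurable M" "I2 \<in> borel_measurable M"
    using rv[of 0] rv[of 1] rv[of 2] rv[of 3] by (auto simp: numeral_eq_Suc)
  have [measurable]: "(\<lambda>x. f (a x) (b x) (c x) (d x)) \<in> borel_measurable L"
    if "a \<in> borel_measurable L" "b \<in> borel_measurable L" "c \<in> borel_measurable L" "d \<in> borel_measurable L"
    for a b c d :: "'c \<Rightarrow> real" and L
  proof -
    have "(\<lambda>x. (a x, b x, c x, d x)) \<in> L \<rightarrow>\<^sub>M borel \<Otimes>\<^sub>M borel \<Otimes>\<^sub>M borel \<Otimes>\<^sub>M borel"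
      using that by measurable
    from measurable_compose[OF this f] show ?thesis by simp
  qed
  define D where "D i = (if i < 4 then distr M borel (?X i) else return borel 0)" for i
  have [measurable_cong, simp]: "sets (D i) = sets borel" for i
    by (auto simp: D_def)
  have "prob_space (D i)" for i
  proof (cases "i < 4")
    case True
    then show ?thesis using rv[of i] by (simp add: D_def prob_space_distr)
  next
    case False
    then show ?thesis by (simp add: D_def prob_space_return)
  qed
  then interpret D: product_sigma_finite D
    by (intro product_sigma_finite.intro prob_space_imp_sigma_finite)
  have set: "{..<4} = insert 0 (insert 1 (insert 2 (insert (3::nat) {})))" by auto
  have eq: "distr M (PiM {..<4} (\<lambda>_. borel)) (\<lambda>x. \<lambda>i\<in>{..<4}. ?X i x) = PiM {..<4} D"
  proof -
    have "distr M (PiM {..<4} (\<lambda>_. borel)) (\<lambda>x. \<lambda>i\<in>{..<4}. ?X i x) = PiM {..<4} (\<lambda>i. distr M borel (?X i))"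
      using indep by (subst (asm) indep_vars_iff_distr_eq_PiM'[OF _ rv]) (auto simp: lessThan_empty_iff)
    then show ?thesis by (auto simp: D_def intro!: PiM_cong)
  qed
  have T: "(\<lambda>x. \<lambda>i\<in>{..<4}. ?X i x) \<in> M \<rightarrow>\<^sub>M PiM {..<4} (\<lambda>_. borel)"
    by (intro measurable_restrict rv)
  have fm: "(\<lambda>x. f (x 0) (x 1) (x 2) (x 3)) \<in> borel_measurable (PiM {..<4::nat} (\<lambda>_. borel))"
    by measurable
  have "(\<integral>\<^sup>+\<omega>. f (R \<omega>) (S \<omega>) (I1 \<omega>) (I2 \<omega>) \<partial>M)
     = (\<integral>\<^sup>+x. f (x 0) (x 1) (x 2) (x 3) \<partial>distr M (PiM {..<4} (\<lambda>_. borel)) (\<lambda>x. \<lambda>i\<in>{..<4}. ?X i x))"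
    using fm by (subst nn_integral_distr[OF T]) (simp_all add: numeral_eq_Suc)
  also have "\<dots> = (\<integral>\<^sup>+x. f (x 0) (x 1) (x 2) (x 3) \<partial>PiM (insert 0 (insert 1 (insert 2 (insert (3::nat) {})))) D)"
    unfolding set[symmetric] eq ..
  also have "\<dots> = (\<integral>\<^sup>+r. \<integral>\<^sup>+s. \<integral>\<^sup>+a. \<integral>\<^sup>+b. f r s a b \<partial>D 3 \<partial>D 2 \<partial>D 1 \<partial>D 0)"
  proof -
    have m0: "(\<lambda>x. f (x 0) (x 1) (x 2) (x 3)) \<in> borel_measurable (PiM (insert 0 {1, 2, 3}) D)"
      by measurable
    have m1: "(\<lambda>x. f r (x 1) (x 2) (x 3)) \<in> borel_measurable (PiM (insert 1 {2, 3}) D)" for r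
      by measurable
    have m2: "(\<lambda>x. f r s (x 2) (x 3)) \<in> borel_measurable (PiM (insert 2 {3}) D)" for r s
      by measurable
    have m3: "(\<lambda>b. f r s a b) \<in> borel_measurable (D 3)" for r s a
      by measurable
    have s3: "(\<integral>\<^sup>+x. f r s a (x 3) \<partial>PiM {3} D) = (\<integral>\<^sup>+b. f r s a b \<partial>D 3)" for r s a
      by (rule D.product_nn_integral_singleton[OF m3])
    have s2: "(\<integral>\<^sup>+x. f r s (x 2) (x 3) \<partial>PiM {2, 3} D) = (\<integral>\<^sup>+a. \<integral>\<^sup>+b. f r s a b \<partial>D 3 \<partial>D 2)" for r s
      by (subst D.product_nn_integral_insert_rev[OF _ _ m2]) (simp_all add: s3)
    have s1: "(\<integral>\<^sup>+x. f r (x 1) (x 2) (x 3) \<partial>PiM {1, 2, 3} D) = (\<integral>\<^sup>+s. \<integral>\<^sup>+a. \<integral>\<^sup>+b. f r s a b \<partial>D 3 \<partial>D 2 \<partial>D 1)" for r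
      by (subst D.product_nn_integral_insert_rev[OF _ _ m1]) (simp_all add: s2)
    show ?thesis
      by (subst D.product_nn_integral_insert_rev[OF _ _ m0]) (simp_all add: s1[simplified])
  qed
  finally show ?thesis by (simp add: D_def numeral_eq_Suc)
qed

text \<open>
  The density of the angle: \<open>g (sin \<theta>) cos \<theta>\<close> is the density of \<open>\<theta> = arcsin S\<close> on \<open>(0, \<pi>/2)\<close>, and the two
  independent signs spread it evenly over the four quadrants.
\<close>

definition folded_density :: "(real \<Rightarrow> real) \<Rightarrow> real \<Rightarrow> real" where
  "folded_density g \<phi> = g \<bar>sin \<phi>\<bar> * \<bar>cos \<phi>\<bar> / 4"

lemma nn_integral_folded_density:
  fixes f :: "real \<times> real \<Rightarrow> ennreal"
  assumes [measurable]: "g \<in> borel_measurable borel" "f \<in> borel_measurable borel"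
    and nonneg: "\<And>s. 0 \<le> g s" and supp: "AE s in lborel. g s \<noteq> 0 \<longrightarrow> s \<in> {0<..<1}"
  shows "(\<integral>\<^sup>+\<phi>\<in>{0<..<2*pi}. (ennreal (folded_density g \<phi>) * f (sin \<phi>, cos \<phi>)) \<partial>lborel)
    = (\<integral>\<^sup>+s. ennreal (g s / 4) * (f (s, sqrt (1 - s\<^sup>2)) + f (s, - sqrt (1 - s\<^sup>2))
        + f (- s, sqrt (1 - s\<^sup>2)) + f (- s, - sqrt (1 - s\<^sup>2))) \<partial>lborel)" (is "_ = (\<integral>\<^sup>+s. ?G s \<partial>lborel)")
proof -
  define H where "H \<phi> = ennreal (folded_density g \<phi>) * f (sin \<phi>, cos \<phi>)" for \<phi>
  have [measurable]: "H \<in> borel_measurable borel"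
    unfolding H_def folded_density_def by measurable
  have "(\<integral>\<^sup>+s. ?G s \<partial>lborel) = (\<integral>\<^sup>+s\<in>{0<..<1}. ?G s \<partial>lborel)"
    by (rule nn_integral_cong_AE) (use supp in eventually_elim, auto simp: indicator_def)
  also have "\<dots> = (\<integral>\<^sup>+x\<in>{0<..<pi/2}. ?G (sin x) * ennreal (cos x) \<partial>lborel)"
    by (subst nn_integral_sin_substitution) auto
  also have "\<dots> = (\<integral>\<^sup>+x\<in>{0<..<pi/2}. (H x + H (2*pi - x) + (H (pi - x) + H (2*pi - (pi - x)))) \<partial>lborel)"
  proof (rule nn_integral_cong)
    fix x :: real
    show "?G (sin x) * ennreal (cos x) * indicator {0<..<pi/2} x
      = (H x + H (2*pi - x) + (H (pi - x) + H (2*pi - (pi - x)))) * indicator {0<..<pi/2} x"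
    proof (cases "x \<in> {0<..<pi/2}")
      case True
      have pos: "0 < sin x" "0 < cos x" using True by (auto intro: sin_gt_zero cos_gt_zero)
      have [simp]: "sqrt (1 - (sin x)\<^sup>2) = cos x"
        using pos by (simp add: cos_squared_eq[symmetric])
      define c where "c = ennreal (g (sin x) * cos x / 4)"
      have c: "ennreal (g (sin x) / 4) * ennreal (cos x) = c"
        using pos nonneg by (simp add: c_def ennreal_mult[symmetric])
      have H: "H x = c * f (sin x, cos x)" "H (2*pi - x) = c * f (- sin x, cos x)"
        "H (pi - x) = c * f (sin x, - cos x)" "H (2*pi - (pi - x)) = c * f (- sin x, - cos x)"
        using pos sin_2pi_minus[of x] cos_2pi_minus[of x] sin_2pi_minus[of "pi - x"] cos_2pi_minus[of "pi - x"]
        by (simp_all add: H_def folded_density_def c_def)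
      have "?G (sin x) * ennreal (cos x) = c *
          (f (sin x, cos x) + f (sin x, - cos x) + f (- sin x, cos x) + f (- sin x, - cos x))"
        unfolding c[symmetric] by (simp add: ac_simps)
      also have "\<dots> = H x + H (2*pi - x) + (H (pi - x) + H (2*pi - (pi - x)))"
        unfolding H by (simp only: distrib_left ac_simps)
      finally show ?thesis by simp
    qed simp
  qed
  also have "\<dots> = (\<integral>\<^sup>+\<phi>\<in>{0<..<2*pi}. H \<phi> \<partial>lborel)"
    using nn_integral_Ioo_fold[of H pi] nn_integral_Ioo_fold[of "\<lambda>x. H x + H (2*pi - x)" "pi/2"]
    by simp
  finally show ?thesis by (simp add: H_def)
qed

lemma isCont_folded_density:
  assumes g: "continuous_on {0<..<1} g" and \<alpha>: "\<alpha> \<in> {0<..<pi/2}"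
  shows "isCont (folded_density g) \<alpha>"
proof -
  have "0 < sin \<alpha>" "sin \<alpha> < sin (pi/2)"
    using \<alpha> sin_monotone_2pi[of \<alpha> "pi/2"] by (auto intro: sin_gt_zero)
  then have "isCont g \<bar>sin \<alpha>\<bar>"
    using g by (simp add: continuous_on_eq_continuous_at)
  moreover have "isCont (\<lambda>\<phi>. \<bar>sin \<phi>\<bar>) \<alpha>" by (intro continuous_intros)
  ultimately have "isCont (\<lambda>\<phi>. g \<bar>sin \<phi>\<bar>) \<alpha>"
    by (rule isCont_o2[rotated])
  then show ?thesis unfolding folded_density_def by (intro continuous_intros) auto
qed

text \<open>
  The folded density is invariant under the reflections in both axes, so its values on one quadrant
  determine it off the multiples of \<open>\<pi>/2\<close>.
\<close>

lemma AE_folded_density_eq: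
  assumes "\<And>\<theta>. \<theta> \<in> {0<..<pi/2} \<Longrightarrow> folded_density g \<theta> = c"
  shows "AE \<phi> in lborel. folded_density g \<phi> = c"
proof -
  let ?Z = "range (\<lambda>k::int. of_int k * pi) \<union> range (\<lambda>k::int. of_int k * pi + pi / 2)"
  have "countable ?Z" by auto
  then have "AE \<phi> in lborel. \<phi> \<notin> ?Z" by (intro AE_not_in countable_imp_null_set_lborel)
  then show ?thesis
  proof eventually_elim
    case (elim \<phi>)
    then have nz: "sin \<phi> \<noteq> 0" "cos \<phi> \<noteq> 0"
      using sin_zero_iff_int2[of \<phi>] cos_zero_iff_int2[of \<phi>] by auto
    define \<theta> where "\<theta> = arcsin \<bar>sin \<phi>\<bar>"
    have s: "sin \<theta> = \<bar>sin \<phi>\<bar>" by (simp add: \<theta>_def)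
    have "cos \<theta> = sqrt (1 - \<bar>sin \<phi>\<bar>\<^sup>2)" unfolding \<theta>_def by (intro cos_arcsin) (auto intro: order_trans[OF _ abs_ge_zero])
    then have co: "cos \<theta> = \<bar>cos \<phi>\<bar>" by (simp add: cos_squared_eq[symmetric])
    have "(sin \<phi>)\<^sup>2 \<noteq> 1" using nz(2) by (auto simp: sin_squared_eq)
    then have "\<bar>sin \<phi>\<bar> \<noteq> 1" by (metis power2_abs power_one)
    then have "\<bar>sin \<phi>\<bar> < 1" by (simp add: less_le)
    then have "\<theta> < arcsin 1" "arcsin 0 < \<theta>"
      unfolding \<theta>_def using nz(1) by (auto intro!: arcsin_less_mono[THEN iffD2] simp del: arcsin_0 arcsin_1)
    then have "\<theta> \<in> {0<..<pi/2}" by simp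
    from assms[OF this] show ?case by (simp add: folded_density_def s co)
  qed
qed

section \<open>Vectors in polar coordinates\<close>

text \<open>
  The setting for the rest of the proof: a radius with law \<open>\<nu>\<close> and an independent angle with
  density \<open>q\<close> on \<open>(0, 2\<pi>)\<close>. The angle is measured from the second axis, so that the coefficients
  \<open>(\<rho>, sqrt (1 - \<rho>\<^sup>2))\<close> of \<open>U(\<rho>)\<close> belong to the angle \<open>\<alpha> = arcsin \<rho>\<close>, and the first axis to \<open>\<pi>/2\<close>.
\<close>

locale polar_vector = R: prob_space \<nu> for \<nu> :: "real measure" +
  fixes q :: "real \<Rightarrow> real"
  assumes sets_nu [measurable_cong, simp]: "sets \<nu> = sets borel"
    and R_pos: "AE r in \<nu>. 0 < r"
    and q_measurable [measurable]: "q \<in> borel_measurable borel"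
    and q_nonneg: "0 \<le> q \<phi>"
    and q_total: "(\<integral>\<^sup>+\<phi>\<in>{0<..<2*pi}. ennreal (q \<phi>) \<partial>lborel) = 1"
begin

definition angle_law :: "real measure" where
  "angle_law = density lborel (\<lambda>\<phi>. ennreal (q \<phi>) * indicator {0<..<2*pi} \<phi>)"

definition law :: "(real \<times> real) measure" where
  "law = distr (\<nu> \<Otimes>\<^sub>M angle_law) borel (\<lambda>(r, \<phi>). (r * sin \<phi>, r * cos \<phi>))"

lemma sets_angle_law [measurable_cong, simp]: "sets angle_law = sets borel"
  by (simp add: angle_law_def)

lemma space_nu [simp]: "space \<nu> = UNIV"
  using sets_eq_imp_space_eq[OF sets_nu] by simp

sublocale Phi: prob_space angle_law
  by (rule prob_spaceI) (simp add: angle_law_def emeasure_density q_total)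

sublocale RPhi: pair_prob_space \<nu> angle_law ..

lemma sets_law [measurable_cong, simp]: "sets law = sets borel" and space_law [simp]: "space law = UNIV"
  by (simp_all add: law_def)

sublocale law: prob_space law
  unfolding law_def by (rule RPhi.prob_space_distr) measurable

lemma nn_integral_angle_law:
  assumes [measurable]: "f \<in> borel_measurable borel"
  shows "(\<integral>\<^sup>+\<phi>. f \<phi> \<partial>angle_law) = (\<integral>\<^sup>+\<phi>\<in>{0<..<2*pi}. (ennreal (q \<phi>) * f \<phi>) \<partial>lborel)"
  unfolding angle_law_def by (subst nn_integral_density) (auto intro!: nn_integral_cong simp: ac_simps)

lemma nn_integral_law:
  assumes [measurable]: "f \<in> borel_measurable borel"
  shows "(\<integral>\<^sup>+x. f x \<partial>law) = (\<integral>\<^sup>+r. (\<integral>\<^sup>+\<phi>\<in>{0<..<2*pi}. (ennreal (q \<phi>) * f (r * sin \<phi>, r * cos \<phi>)) \<partial>lborel) \<partial>\<nu>)"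
proof -
  have "(\<integral>\<^sup>+x. f x \<partial>law) = (\<integral>\<^sup>+p. f (fst p * sin (snd p), fst p * cos (snd p)) \<partial>(\<nu> \<Otimes>\<^sub>M angle_law))"
    unfolding law_def by (subst nn_integral_distr) (auto simp: case_prod_beta')
  also have "\<dots> = (\<integral>\<^sup>+r. \<integral>\<^sup>+\<phi>. f (r * sin \<phi>, r * cos \<phi>) \<partial>angle_law \<partial>\<nu>)"
    by (subst Phi.nn_integral_fst[symmetric]) auto
  also have "\<dots> = (\<integral>\<^sup>+r. (\<integral>\<^sup>+\<phi>\<in>{0<..<2*pi}. (ennreal (q \<phi>) * f (r * sin \<phi>, r * cos \<phi>)) \<partial>lborel) \<partial>\<nu>)"
    by (intro nn_integral_cong nn_integral_angle_law) measurable
  finally show ?thesis .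
qed

end

lemma borel_measurable_has_real_density:
  assumes "has_real_density N X f"
  shows "f \<in> borel_measurable borel"
proof -
  have "(\<lambda>x. ennreal (f x)) \<in> borel_measurable borel" and "\<And>x. 0 \<le> f x"
    using assms by (auto simp: has_real_density_def distributed_def)
  then show ?thesis using borel_measurable_enn2real[of "\<lambda>x. ennreal (f x)" borel] by simp
qed

text \<open>
  Passage from the signed representation to polar coordinates: conditionally on the radius, averaging over
  the four sign patterns is the same as integrating against the folded density.
\<close>

lemma law_signed_polar:
  fixes R S I1 I2 :: "'a \<Rightarrow> real"
  assumes M: "prob_space M" and indep: "prob_space.indep_vars M (\<lambda>_. borel) (\<lambda>i. [R, S, I1, I2] ! i) {..<4}"
    and pos: "AE \<omega> in M. 0 < R \<omega>" 
    and S: "AE \<omega> in M. S \<omega> \<in> {0<..<1}" and g: "has_real_density M S g"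
    and I1: "measure M {\<omega> \<in> space M. I1 \<omega> = 1} = 1 / 2" "measure M {\<omega> \<in> space M. I1 \<omega> = -1} = 1 / 2"
    and I2: "measure M {\<omega> \<in> space M. I2 \<omega> = 1} = 1 / 2" "measure M {\<omega> \<in> space M. I2 \<omega> = -1} = 1 / 2"
  shows "polar_vector (distr M borel R) (folded_density g)" (is ?P)
    and "distr M borel (\<lambda>\<omega>. R \<omega> *\<^sub>R (I1 \<omega> * S \<omega>, I2 \<omega> * sqrt (1 - (S \<omega>)\<^sup>2)))
         = polar_vector.law (distr M borel R) (folded_density g)" (is "?L = _")
proof -
  interpret prob_space M by fact
  have rv: "\<And>i. i \<in> {..<4} \<Longrightarrow> random_variable borel ([R, S, I1, I2] ! i)"
    using indep unfolding indep_vars_def by auto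
  have [measurable]: "R \<in> borel_measurable M" "S \<in> borel_measurable M" "I1 \<in> borel_measurable M" "I2 \<in> borel_measurable M"
    using rv[of 0] rv[of 1] rv[of 2] rv[of 3] by (auto simp: numeral_eq_Suc)
  have g_nonneg: "0 \<le> g s" for s
    using g by (simp add: has_real_density_def)
  have distS: "distr M lborel S = density lborel (\<lambda>s. ennreal (g s))"
    using g by (simp add: has_real_density_def distributed_def)
  note borel_measurable_has_real_density[OF g, measurable]
  have distS': "distr M borel S = density lborel (\<lambda>s. ennreal (g s))"
    using distS by (simp add: cong: distr_cong)
  have supp: "AE s in lborel. g s \<noteq> 0 \<longrightarrow> s \<in> {0<..<1}"
  proof -
    have "AE s in distr M borel S. s \<in> {0<..<1}" using S by (subst AE_distr_iff) auto
    then have "AE s in lborel. 0 < ennreal (g s) \<longrightarrow> s \<in> {0<..<1}"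
      unfolding distS' by (subst (asm) AE_density) auto
    then show ?thesis by eventually_elim (use g_nonneg in \<open>auto simp: less_le\<close>)
  qed
  have tot: "(\<integral>\<^sup>+s. ennreal (g s) \<partial>lborel) = 1"
  proof -
    interpret S: prob_space "distr M borel S" by (rule prob_space_distr) simp
    have "emeasure (density lborel (\<lambda>s. ennreal (g s))) UNIV = 1"
      using S.emeasure_space_1 unfolding distS' by simp
    then show ?thesis by (simp add: emeasure_density)
  qed
  have "(\<integral>\<^sup>+\<phi>\<in>{0<..<2*pi}. ennreal (folded_density g \<phi>) \<partial>lborel)
      = (\<integral>\<^sup>+s. ennreal (g s / 4) * (1 + 1 + 1 + 1) \<partial>lborel)"
    using nn_integral_folded_density[of g "\<lambda>_. 1"] g_nonneg supp by simp
  also have "\<dots> = (\<integral>\<^sup>+s. ennreal (g s) \<partial>lborel)"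
  proof (rule nn_integral_cong)
    fix s
    have "ennreal (g s / 4) * 4 = ennreal (g s / 4 * 4)"
      by (subst ennreal_mult) (simp_all add: g_nonneg)
    then show "ennreal (g s / 4) * (1 + 1 + 1 + 1) = ennreal (g s)" by simp
  qed
  finally have q_tot: "(\<integral>\<^sup>+\<phi>\<in>{0<..<2*pi}. ennreal (folded_density g \<phi>) \<partial>lborel) = 1"
    using tot by simp
  have "AE r in distr M borel R. 0 < r" using pos by (subst AE_distr_iff) auto
  moreover have "folded_density g \<in> borel_measurable borel"
    unfolding folded_density_def[abs_def] by measurable
  ultimately show P: ?P
    by (intro polar_vector.intro polar_vector_axioms.intro prob_space_distr)
       (simp_all add: q_tot, simp add: folded_density_def g_nonneg)
  interpret V: polar_vector "distr M borel R" "folded_density g" by (rule P)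
  show "?L = V.law"
  proof (rule measure_eqI)
    fix B assume "B \<in> sets ?L"
    then have B [measurable]: "B \<in> sets (borel :: (real \<times> real) measure)" by simp
    define h where "h r s a b = (indicator B (r * (a * s), r * (b * sqrt (1 - s\<^sup>2))) :: ennreal)" for r s a b :: real
    have h [measurable]: "(\<lambda>(r, s, a, b). h r s a b) \<in> borel_measurable (borel \<Otimes>\<^sub>M borel \<Otimes>\<^sub>M borel \<Otimes>\<^sub>M borel)"
      unfolding h_def by measurable
    have [measurable]: "(\<lambda>s. h r s a b) \<in> borel_measurable borel" for r a b
      unfolding h_def by measurable
    have "emeasure ?L B = (\<integral>\<^sup>+x. indicator B x \<partial>?L)" by simp
    also have "\<dots> = (\<integral>\<^sup>+\<omega>. h (R \<omega>) (S \<omega>) (I1 \<omega>) (I2 \<omega>) \<partial>M)"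
      by (subst nn_integral_distr) (auto simp: h_def)
    also have "\<dots> = (\<integral>\<^sup>+r. \<integral>\<^sup>+s. \<integral>\<^sup>+a. \<integral>\<^sup>+b. h r s a b \<partial>distr M borel I2 \<partial>distr M borel I1 \<partial>distr M borel S \<partial>distr M borel R)"
      by (rule nn_integral_four_indep[OF M indep h])
    also have "\<dots> = (\<integral>\<^sup>+r. \<integral>\<^sup>+s. ennreal (g s) * (((h r s 1 1 + h r s 1 (-1)) / 2 + (h r s (-1) 1 + h r s (-1) (-1)) / 2) / 2) \<partial>lborel \<partial>distr M borel R)"
      by (subst nn_integral_sign[OF M _ I2], simp, simp, subst nn_integral_sign[OF M _ I1], simp, simp)
         (simp add: distS' nn_integral_density)
    also have "\<dots> = (\<integral>\<^sup>+r. (\<integral>\<^sup>+\<phi>\<in>{0<..<2*pi}. (ennreal (folded_density g \<phi>) * indicator B (r * sin \<phi>, r * cos \<phi>)) \<partial>lborel) \<partial>distr M borel R)"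
    proof (rule nn_integral_cong)
      fix r :: real
      have "(\<lambda>x::real \<times> real. (r * fst x, r * snd x)) \<in> borel \<rightarrow>\<^sub>M borel"
        unfolding borel_prod[symmetric] by measurable
      then have "(\<lambda>x. indicator B (r * fst x, r * snd x) :: ennreal) \<in> borel_measurable borel"
        by (rule measurable_compose) measurable
      then have "(\<integral>\<^sup>+\<phi>\<in>{0<..<2*pi}. (ennreal (folded_density g \<phi>) * indicator B (r * sin \<phi>, r * cos \<phi>)) \<partial>lborel)
        = (\<integral>\<^sup>+s. ennreal (g s / 4) * (h r s 1 1 + h r s 1 (-1) + h r s (-1) 1 + h r s (-1) (-1)) \<partial>lborel)"
        using nn_integral_folded_density[of g "\<lambda>x. indicator B (r * fst x, r * snd x)"] g_nonneg supp
        by (simp add: h_def)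
      also have "\<dots> = (\<integral>\<^sup>+s. ennreal (g s) * (((h r s 1 1 + h r s 1 (-1)) / 2 + (h r s (-1) 1 + h r s (-1) (-1)) / 2) / 2) \<partial>lborel)"
      proof (rule nn_integral_cong)
        fix s
        have "ennreal (g s / 4) = ennreal (g s) * ennreal (1/2) * ennreal (1/2)"
          using g_nonneg[of s] ennreal_mult[of "g s * (1/2)" "1/2"] ennreal_mult[of "g s" "1/2"]
          by (simp del: ennreal_mult' ennreal_mult'')
        moreover have "x / 2 = x * ennreal (1/2)" for x :: ennreal
          by (simp add: divide_ennreal_def inverse_ennreal[symmetric] flip: ennreal_numeral)
        ultimately show "ennreal (g s / 4) * (h r s 1 1 + h r s 1 (-1) + h r s (-1) 1 + h r s (-1) (-1))
           = ennreal (g s) * (((h r s 1 1 + h r s 1 (-1)) / 2 + (h r s (-1) 1 + h r s (-1) (-1)) / 2) / 2)"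
          by (simp only: distrib_left distrib_right ac_simps)
      qed
      finally show "(\<integral>\<^sup>+s. ennreal (g s) * (((h r s 1 1 + h r s 1 (-1)) / 2 + (h r s (-1) 1 + h r s (-1) (-1)) / 2) / 2) \<partial>lborel)
        = (\<integral>\<^sup>+\<phi>\<in>{0<..<2*pi}. (ennreal (folded_density g \<phi>) * indicator B (r * sin \<phi>, r * cos \<phi>)) \<partial>lborel)" by simp
    qed
    also have "\<dots> = (\<integral>\<^sup>+x. indicator B x \<partial>V.law)"
      by (subst V.nn_integral_law) auto
    finally show "emeasure ?L B = emeasure V.law B" by simp
  qed simp
qed

section \<open>Tails in a given direction\<close>

context polar_vector
begin

definition radial_tail :: "real \<Rightarrow> real" where
  "radial_tail x = measure \<nu> {x<..}"

definition directional_tail :: "real \<Rightarrow> real \<Rightarrow> real" where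
  "directional_tail \<alpha> u = measure law {x. u < sin \<alpha> * fst x + cos \<alpha> * snd x}"

text \<open>
  The contribution of the angles within \<open>\<delta>\<close> of a direction, computed as if the angle had density \<open>1\<close>
  there. It does not depend on the direction and serves as the common unit of comparison.
\<close>

definition cap_tail :: "real \<Rightarrow> real \<Rightarrow> real" where
  "cap_tail \<delta> u = enn2real (\<integral>\<^sup>+t\<in>{-\<delta><..<\<delta>}. emeasure \<nu> {u / cos t<..} \<partial>lborel)"

lemma emeasure_nu_Collect_measurable:
  assumes [measurable]: "Measurable.pred (L \<Otimes>\<^sub>M borel) (\<lambda>p. P (fst p) (snd p))"
  shows "(\<lambda>x. emeasure \<nu> {r. P x r}) \<in> borel_measurable L"
proof -
  have *: "{p \<in> space (L \<Otimes>\<^sub>M \<nu>). P (fst p) (snd p)} \<in> sets (L \<Otimes>\<^sub>M \<nu>)"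
    by measurable
  have "(\<lambda>x. emeasure \<nu> (Pair x -` {p \<in> space (L \<Otimes>\<^sub>M \<nu>). P (fst p) (snd p)})) \<in> borel_measurable L"
    by (rule R.measurable_emeasure_Pair[OF *])
  then show ?thesis
    by (rule measurable_cong[THEN iffD1, rotated]) (auto simp: space_pair_measure vimage_def)
qed

lemma emeasure_nu_tail_measurable [measurable]:
  "(\<lambda>t. emeasure \<nu> {u / cos (t + c)<..}) \<in> borel_measurable borel"
  using emeasure_nu_Collect_measurable[where L=borel and P="\<lambda>t r. u / cos (t + c) < r"]
  by (simp add: greaterThan_def)

lemma emeasure_nu_halfline_measurable [measurable]:
  "(\<lambda>\<phi>. emeasure \<nu> {r. u < r * cos (\<phi> - \<alpha>)}) \<in> borel_measurable borel"
  by (rule emeasure_nu_Collect_measurable) measurable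

lemma ennreal_directional_tail:
  "ennreal (directional_tail \<alpha> u)
    = (\<integral>\<^sup>+\<phi>\<in>{0<..<2*pi}. (ennreal (q \<phi>) * emeasure \<nu> {r. u < r * cos (\<phi> - \<alpha>)}) \<partial>lborel)"
proof -
  let ?A = "{p :: real \<times> real. u < fst p * cos (snd p - \<alpha>)}"
  have A: "?A \<in> sets (\<nu> \<Otimes>\<^sub>M angle_law)"
  proof -
    have "{p \<in> space (\<nu> \<Otimes>\<^sub>M angle_law). u < fst p * cos (snd p - \<alpha>)} \<in> sets (\<nu> \<Otimes>\<^sub>M angle_law)"
      by measurable
    then show ?thesis by (simp add: space_pair_measure angle_law_def)
  qed
  have H: "{x :: real \<times> real. u < sin \<alpha> * fst x + cos \<alpha> * snd x} \<in> sets borel"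
    by (intro borel_open open_Collect_less continuous_intros)
  have "ennreal (directional_tail \<alpha> u) = emeasure law {x. u < sin \<alpha> * fst x + cos \<alpha> * snd x}"
    by (simp add: directional_tail_def law.emeasure_eq_measure)
  also have "\<dots> = emeasure (\<nu> \<Otimes>\<^sub>M angle_law) ?A"
    unfolding law_def using H
    by (subst emeasure_distr)
       (auto intro!: arg_cong[where f="emeasure _"] simp: space_pair_measure angle_law_def cos_diff algebra_simps)
  also have "\<dots> = (\<integral>\<^sup>+\<phi>. emeasure \<nu> {r. u < r * cos (\<phi> - \<alpha>)} \<partial>angle_law)"
    using A by (subst RPhi.emeasure_pair_measure_alt2) (auto simp: vimage_def)
  finally show ?thesis
    by (subst (asm) nn_integral_angle_law) measurable
qed

lemma ennreal_cap_tail: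
  "ennreal (cap_tail \<delta> u) = (\<integral>\<^sup>+t\<in>{-\<delta><..<\<delta>}. emeasure \<nu> {u / cos t<..} \<partial>lborel)"
proof -
  have "(\<integral>\<^sup>+t\<in>{-\<delta><..<\<delta>}. emeasure \<nu> {u / cos t<..} \<partial>lborel) \<le> (\<integral>\<^sup>+t. indicator {-\<delta><..<\<delta>} t \<partial>lborel)"
    by (intro nn_integral_mono) (auto simp: indicator_def R.emeasure_le_1)
  also have "\<dots> = emeasure lborel {-\<delta><..<\<delta>}" by simp
  also have "\<dots> < \<top>" by (cases "0 \<le> \<delta>") auto
  finally show ?thesis by (simp add: cap_tail_def)
qed

lemma nn_integral_cap_shift:
  "(\<integral>\<^sup>+\<phi>\<in>{\<alpha>-\<delta><..<\<alpha>+\<delta>}. emeasure \<nu> {u / cos (\<phi> - \<alpha>)<..} \<partial>lborel) = ennreal (cap_tail \<delta> u)"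
  using emeasure_nu_tail_measurable[of u "-\<alpha>"]
  by (subst nn_integral_Ioo_shift[where t=\<alpha>]) (simp_all add: ennreal_cap_tail)

lemma cap_tail_nonneg [simp]: "0 \<le> cap_tail \<delta> u"
  and radial_tail_nonneg [simp]: "0 \<le> radial_tail u"
  and directional_tail_nonneg [simp]: "0 \<le> directional_tail \<alpha> u"
  by (simp_all add: cap_tail_def radial_tail_def directional_tail_def)

lemma radial_tail_antimono: "x \<le> y \<Longrightarrow> radial_tail y \<le> radial_tail x"
  unfolding radial_tail_def by (intro R.finite_measure_mono) auto

text \<open>
  Given \<open>u < R cos (\<phi> - \<alpha>)\<close>, either \<open>\<phi>\<close> is within \<open>\<delta>\<close> of \<open>\<alpha>\<close>, which contributes at most \<open>x\<close> times the
  cap integral, or \<open>cos (\<phi> - \<alpha>) \<le> cos \<delta>\<close> and already \<open>R\<close> alone exceeds \<open>u / cos \<delta>\<close>.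
\<close>

lemma directional_tail_le:
  assumes u: "0 < u" and \<delta>: "0 < \<delta>" "\<delta> < \<alpha>" "\<alpha> + \<delta> \<le> pi / 2"
    and x: "0 \<le> x" "\<And>\<phi>. \<bar>\<phi> - \<alpha>\<bar> < \<delta> \<Longrightarrow> q \<phi> \<le> x"
  shows "directional_tail \<alpha> u \<le> x * cap_tail \<delta> u + radial_tail (u / cos \<delta>)"
proof -
  have cd: "0 < cos \<delta>" using \<delta> by (intro cos_gt_zero) auto
  have point: "ennreal (q \<phi>) * emeasure \<nu> {r. u < r * cos (\<phi> - \<alpha>)} * indicator {0<..<2*pi} \<phi>
      \<le> ennreal x * (emeasure \<nu> {u / cos (\<phi> - \<alpha>)<..} * indicator {\<alpha>-\<delta><..<\<alpha>+\<delta>} \<phi>)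
        + emeasure \<nu> {u / cos \<delta><..} * (ennreal (q \<phi>) * indicator {0<..<2*pi} \<phi>)"
    (is "?l \<le> ?a + ?b") for \<phi>
  proof (cases "\<bar>\<phi> - \<alpha>\<bar> < \<delta>")
    case True
    then have "0 < cos (\<phi> - \<alpha>)" using \<delta> by (intro cos_gt_zero_pi) auto
    then have "{r. u < r * cos (\<phi> - \<alpha>)} = {u / cos (\<phi> - \<alpha>)<..}"
      by (auto simp: field_simps)
    moreover have "ennreal (q \<phi>) \<le> ennreal x" using x(2)[OF True] by (rule ennreal_leI)
    moreover have "\<phi> \<in> {\<alpha>-\<delta><..<\<alpha>+\<delta>}" using True by auto
    ultimately have "?l \<le> ?a"
      by (cases "\<phi> \<in> {0<..<2*pi}") (simp_all add: mult_right_mono)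
    then show ?thesis by (rule order_trans) simp
  next
    case False
    show ?thesis
    proof (cases "\<phi> \<in> {0<..<2*pi}")
      case range: True
      have le: "cos (\<phi> - \<alpha>) \<le> cos \<delta>"
      proof (cases "\<bar>\<phi> - \<alpha>\<bar> \<le> pi")
        case True
        then have "cos \<bar>\<phi> - \<alpha>\<bar> \<le> cos \<delta>"
          using False \<delta> by (intro cos_monotone_0_pi_le) auto
        then show ?thesis by simp
      next
        case far: False
        then have "cos (2 * pi - \<bar>\<phi> - \<alpha>\<bar>) \<le> cos \<delta>"
          using range \<delta> by (intro cos_monotone_0_pi_le) auto
        then show ?thesis by (simp only: cos_2pi_minus cos_abs_real)
      qed
      have "AE r in \<nu>. r \<in> {r. u < r * cos (\<phi> - \<alpha>)} \<longrightarrow> r \<in> {u / cos \<delta><..}"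
        using R_pos
      proof eventually_elim
        case (elim r)
        then have "r * cos (\<phi> - \<alpha>) \<le> r * cos \<delta>" using le by (intro mult_left_mono) auto
        then show ?case using cd by (auto simp: field_simps)
      qed
      then have "emeasure \<nu> {r. u < r * cos (\<phi> - \<alpha>)} \<le> emeasure \<nu> {u / cos \<delta><..}"
        by (intro emeasure_mono_AE) auto
      then have "ennreal (q \<phi>) * emeasure \<nu> {r. u < r * cos (\<phi> - \<alpha>)} \<le> ennreal (q \<phi>) * emeasure \<nu> {u / cos \<delta><..}"
        by (rule mult_left_mono) simp
      then have "?l \<le> ?b" using range by (simp add: mult.commute)
      then show ?thesis by (rule order_trans) simp
    qed simp
  qed
  have "ennreal (directional_tail \<alpha> u) \<le> (\<integral>\<^sup>+\<phi>. ennreal x * (emeasure \<nu> {u / cos (\<phi> - \<alpha>)<..} * indicator {\<alpha>-\<delta><..<\<alpha>+\<delta>} \<phi>)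
        + emeasure \<nu> {u / cos \<delta><..} * (ennreal (q \<phi>) * indicator {0<..<2*pi} \<phi>) \<partial>lborel)"
    unfolding ennreal_directional_tail by (intro nn_integral_mono point)
  also have "\<dots> = ennreal x * ennreal (cap_tail \<delta> u) + emeasure \<nu> {u / cos \<delta><..}"
    using emeasure_nu_tail_measurable[of u "-\<alpha>"]
    by (simp add: nn_integral_add nn_integral_cmult nn_integral_cap_shift q_total)
  also have "\<dots> = ennreal (x * cap_tail \<delta> u + radial_tail (u / cos \<delta>))"
    using x(1) by (simp add: radial_tail_def R.emeasure_eq_measure ennreal_mult)
  finally show ?thesis
    using x(1) by (subst (asm) ennreal_le_iff) auto
qed

lemma directional_tail_ge:
  assumes \<delta>: "\<delta> \<le> pi / 2" "\<delta> \<le> \<alpha>" "\<alpha> + \<delta> \<le> 2 * pi"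
    and y: "0 \<le> y" "\<And>\<phi>. \<bar>\<phi> - \<alpha>\<bar> < \<delta> \<Longrightarrow> y \<le> q \<phi>"
  shows "y * cap_tail \<delta> u \<le> directional_tail \<alpha> u"
proof -
  have "ennreal (y * cap_tail \<delta> u)
      = (\<integral>\<^sup>+\<phi>. ennreal y * (emeasure \<nu> {u / cos (\<phi> - \<alpha>)<..} * indicator {\<alpha>-\<delta><..<\<alpha>+\<delta>} \<phi>) \<partial>lborel)"
    using emeasure_nu_tail_measurable[of u "-\<alpha>"] y(1)
    by (simp add: nn_integral_cmult nn_integral_cap_shift ennreal_mult)
  also have "\<dots> \<le> ennreal (directional_tail \<alpha> u)"
    unfolding ennreal_directional_tail
  proof (intro nn_integral_mono)
    fix \<phi>
    show "ennreal y * (emeasure \<nu> {u / cos (\<phi> - \<alpha>)<..} * indicator {\<alpha>-\<delta><..<\<alpha>+\<delta>} \<phi>)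
      \<le> ennreal (q \<phi>) * emeasure \<nu> {r. u < r * cos (\<phi> - \<alpha>)} * indicator {0<..<2*pi} \<phi>"
    proof (cases "\<bar>\<phi> - \<alpha>\<bar> < \<delta>")
      case True
      then have "0 < cos (\<phi> - \<alpha>)" using \<delta> by (intro cos_gt_zero_pi) auto
      then have "{r. u < r * cos (\<phi> - \<alpha>)} = {u / cos (\<phi> - \<alpha>)<..}"
        by (auto simp: field_simps)
      moreover have "ennreal y \<le> ennreal (q \<phi>)" using y(2)[OF True] by (rule ennreal_leI)
      moreover have "\<phi> \<in> {0<..<2*pi}" "\<phi> \<in> {\<alpha>-\<delta><..<\<alpha>+\<delta>}" using True \<delta> by auto
      ultimately show ?thesis by (simp add: mult_right_mono)
    qed (auto simp: indicator_def abs_less_iff)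
  qed
  finally show ?thesis by simp
qed

text \<open>
  On the half cap \<open>\<bar>t\<bar> < \<delta>/2\<close>, which has length \<open>\<delta>\<close>, the integrand is at least its value at the rim.
  The strictly smaller angle is what makes \<open>T(u / cos \<delta>)\<close> negligible against the cap integral under rapid variation.
\<close>

lemma cap_tail_ge:
  assumes u: "0 < u" and \<delta>: "0 < \<delta>" "\<delta> \<le> pi / 2"
  shows "\<delta> * radial_tail (u / cos (\<delta> / 2)) \<le> cap_tail \<delta> u"
proof -
  have "ennreal (\<delta> * radial_tail (u / cos (\<delta> / 2)))
      = (\<integral>\<^sup>+t. emeasure \<nu> {u / cos (\<delta> / 2)<..} * indicator {-\<delta>/2<..<\<delta>/2} t \<partial>lborel)"
    using \<delta> by (simp add: nn_integral_cmult radial_tail_def R.emeasure_eq_measure ennreal_mult ac_simps)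
  also have "\<dots> \<le> ennreal (cap_tail \<delta> u)"
    unfolding ennreal_cap_tail
  proof (intro nn_integral_mono)
    fix t
    show "emeasure \<nu> {u / cos (\<delta> / 2)<..} * indicator {-\<delta>/2<..<\<delta>/2} t
      \<le> emeasure \<nu> {u / cos t<..} * indicator {-\<delta><..<\<delta>} t"
    proof (cases "\<bar>t\<bar> < \<delta> / 2")
      case True
      have c: "0 < cos (\<delta> / 2)" using \<delta> by (intro cos_gt_zero) auto
      have "cos (\<delta> / 2) \<le> cos \<bar>t\<bar>" using True \<delta> by (intro cos_monotone_0_pi_le) auto
      then have "u / cos t \<le> u / cos (\<delta> / 2)" using u c by (intro divide_left_mono) auto
      then have "emeasure \<nu> {u / cos (\<delta> / 2)<..} \<le> emeasure \<nu> {u / cos t<..}"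
        by (intro emeasure_mono) auto
      then show ?thesis using True by (auto simp: indicator_def)
    qed (auto simp: indicator_def abs_less_iff)
  qed
  finally show ?thesis by simp
qed

text \<open>
  If \<open>q \<alpha> < q \<beta>\<close>, then by continuity \<open>q\<close> stays below some \<open>x\<close> near \<open>\<alpha>\<close> and above some \<open>y > x\<close> near
  \<open>\<beta>\<close>. Since the error term is eventually at most \<open>d\<close> times the cap integral with \<open>x + d < y\<close>, the quotient
  of the tails is eventually at most \<open>(x + d) / y < 1\<close>, so it cannot tend to \<open>1\<close>.
\<close>

lemma angular_density_mono_of_ratio:
  assumes Fl: "Fl \<noteq> bot" "\<forall>\<^sub>F u in Fl. 0 < u"
    and rapid: "\<And>\<delta> e. 0 < \<delta> \<Longrightarrow> \<delta> < pi / 2 \<Longrightarrow> 0 < e \<Longrightarrow>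
      \<forall>\<^sub>F u in Fl. radial_tail (u / cos \<delta>) \<le> e * radial_tail (u / cos (\<delta> / 2))"
    and \<alpha>: "\<alpha> \<in> {0<..<pi/2}" "isCont q \<alpha>" and \<beta>: "\<beta> \<in> {0<..<pi/2}" "isCont q \<beta>"
    and lim: "((\<lambda>u. directional_tail \<alpha> u / directional_tail \<beta> u) \<longlongrightarrow> 1) Fl"
  shows "q \<beta> \<le> q \<alpha>"
proof (rule ccontr)
  assume "\<not> q \<beta> \<le> q \<alpha>"
  \<comment> \<open>A quarter of the gap: two quarters for the oscillation of \<open>q\<close>, one for the error term, one to spare.\<close>
  define d where "d = (q \<beta> - q \<alpha>) / 4"
  define x where "x = q \<alpha> + d"
  define y where "y = q \<beta> - d"
  have d: "0 < d" "x + d < y" "0 \<le> x" "0 < y"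
    using \<open>\<not> q \<beta> \<le> q \<alpha>\<close> q_nonneg[of \<alpha>] by (auto simp: d_def x_def y_def field_simps)
  from \<alpha>(2) d(1) obtain \<delta>1 where \<delta>1: "0 < \<delta>1" "\<And>\<phi>. \<bar>\<phi> - \<alpha>\<bar> < \<delta>1 \<Longrightarrow> \<bar>q \<phi> - q \<alpha>\<bar> < d"
    unfolding continuous_at_eps_delta dist_real_def by metis
  from \<beta>(2) d(1) obtain \<delta>2 where \<delta>2: "0 < \<delta>2" "\<And>\<phi>. \<bar>\<phi> - \<beta>\<bar> < \<delta>2 \<Longrightarrow> \<bar>q \<phi> - q \<beta>\<bar> < d"
    unfolding continuous_at_eps_delta dist_real_def by metis
  define \<delta> where "\<delta> = Min {\<delta>1, \<delta>2, \<alpha> / 2, \<beta> / 2, (pi/2 - \<alpha>) / 2, (pi/2 - \<beta>) / 2}"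
  have \<delta>: "0 < \<delta>" "\<delta> \<le> \<delta>1" "\<delta> \<le> \<delta>2" "\<delta> \<le> \<alpha> / 2" "\<delta> \<le> \<beta> / 2" "\<delta> \<le> (pi/2 - \<alpha>) / 2" "\<delta> \<le> (pi/2 - \<beta>) / 2"
    unfolding \<delta>_def using \<delta>1(1) \<delta>2(1) \<alpha>(1) \<beta>(1) by (subst Min_gr_iff; simp) (rule Min_le; simp)+
  have \<delta>': "\<delta> < pi / 2" "\<delta> < \<alpha>" "\<alpha> + \<delta> \<le> pi / 2" "\<delta> \<le> \<beta>" "\<beta> + \<delta> \<le> 2 * pi"
    using \<delta> \<alpha>(1) \<beta>(1) by (auto simp: field_simps)
  have qx: "q \<phi> \<le> x" if "\<bar>\<phi> - \<alpha>\<bar> < \<delta>" for \<phi>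
    using \<delta>1(2)[of \<phi>] that \<delta>(2) by (auto simp: x_def)
  have qy: "y \<le> q \<phi>" if "\<bar>\<phi> - \<beta>\<bar> < \<delta>" for \<phi>
    using \<delta>2(2)[of \<phi>] that \<delta>(3) by (auto simp: y_def)
  have "\<forall>\<^sub>F u in Fl. radial_tail (u / cos \<delta>) \<le> (d * \<delta>) * radial_tail (u / cos (\<delta> / 2))"
    using d(1) \<delta>(1) \<delta>'(1) by (intro rapid) auto
  with Fl(2) have "\<forall>\<^sub>F u in Fl. directional_tail \<alpha> u / directional_tail \<beta> u \<le> (x + d) / y"
  proof eventually_elim
    case (elim u)
    have "d * (\<delta> * radial_tail (u / cos (\<delta> / 2))) \<le> d * cap_tail \<delta> u"
      using d(1) elim(1) \<delta>(1) \<delta>'(1) by (intro mult_left_mono cap_tail_ge) auto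
    then have "radial_tail (u / cos \<delta>) \<le> d * cap_tail \<delta> u"
      using elim(2) by (simp add: ac_simps)
    then have "directional_tail \<alpha> u \<le> (x + d) * cap_tail \<delta> u"
      using directional_tail_le[OF elim(1) \<delta>(1) \<delta>'(2,3) d(3) qx] by (simp add: distrib_right)
    moreover have "y * cap_tail \<delta> u \<le> directional_tail \<beta> u"
      using \<delta>' d qy by (intro directional_tail_ge) auto
    then have "(x + d) * cap_tail \<delta> u \<le> (x + d) / y * directional_tail \<beta> u"
      using d mult_left_mono[of "y * cap_tail \<delta> u" "directional_tail \<beta> u" "(x + d) / y"] by simp
    ultimately have "directional_tail \<alpha> u \<le> (x + d) / y * directional_tail \<beta> u" by simp
    then show ?case
      using d by (cases "directional_tail \<beta> u = 0") (auto simp: divide_le_eq less_le)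
  qed
  then have "1 \<le> (x + d) / y"
    by (rule tendsto_upperbound[OF lim _ Fl(1)])
  then show False using d by simp
qed

text \<open>
  Within a sufficiently small cap \<open>u / cos t\<close> stays below \<open>v\<close>, so the cap integral is positive.
\<close>

lemma directional_tail_pos:
  assumes \<alpha>: "\<alpha> \<in> {0<..<pi/2}" "isCont q \<alpha>" "0 < q \<alpha>" and u: "0 < u" "u < v" "0 < radial_tail v"
  shows "0 < directional_tail \<alpha> u"
proof -
  have "0 < q \<alpha> / 2" using \<alpha>(3) by simp
  with \<alpha>(2) obtain \<delta>1 where \<delta>1: "0 < \<delta>1" "\<And>\<phi>. \<bar>\<phi> - \<alpha>\<bar> < \<delta>1 \<Longrightarrow> \<bar>q \<phi> - q \<alpha>\<bar> < q \<alpha> / 2"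
    unfolding continuous_at_eps_delta dist_real_def by metis
  have "isCont cos (0::real)" "0 < 1 - u / v" using u by (auto simp: continuous_intros)
  then obtain \<delta>2 where \<delta>2: "0 < \<delta>2" "\<And>t. \<bar>t - 0\<bar> < \<delta>2 \<Longrightarrow> \<bar>cos t - cos 0\<bar> < 1 - u / v"
    unfolding continuous_at_eps_delta dist_real_def by metis
  define \<delta> where "\<delta> = Min {\<delta>1, \<delta>2, \<alpha>, pi/2 - \<alpha>}"
  have \<delta>: "0 < \<delta>" "\<delta> \<le> \<delta>1" "\<delta> \<le> \<delta>2" "\<delta> \<le> \<alpha>" "\<delta> \<le> pi/2 - \<alpha>"
    using \<delta>1(1) \<delta>2(1) \<alpha>(1) by (auto simp: \<delta>_def)
  have "\<bar>cos (\<delta>/2) - cos 0\<bar> < 1 - u / v" using \<delta> by (intro \<delta>2) auto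
  then have c: "u / v < cos (\<delta>/2)" by (simp add: abs_if split: if_splits)
  moreover have "0 < cos (\<delta>/2)" using c u divide_pos_pos[of u v] by linarith
  ultimately have "u / cos (\<delta>/2) \<le> v"
    using u by (simp add: field_simps)
  then have "0 < radial_tail (u / cos (\<delta>/2))"
    using u radial_tail_antimono by fastforce
  then have "0 < \<delta> * radial_tail (u / cos (\<delta>/2))" using \<delta>(1) by simp
  also have "\<dots> \<le> cap_tail \<delta> u" using \<delta> \<alpha> u by (intro cap_tail_ge) auto
  finally have "0 < q \<alpha> / 2 * cap_tail \<delta> u" using \<alpha>(3) by simp
  also have "\<dots> \<le> directional_tail \<alpha> u"
  proof (rule directional_tail_ge)
    fix \<phi> assume "\<bar>\<phi> - \<alpha>\<bar> < \<delta>"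
    then have "\<bar>q \<phi> - q \<alpha>\<bar> < q \<alpha> / 2" using \<delta> by (intro \<delta>1) auto
    then show "q \<alpha> / 2 \<le> q \<phi>" by (simp add: abs_if split: if_splits)
  qed (use \<delta> \<alpha> pi_gt_zero in auto)
  finally show ?thesis .
qed

lemma radial_tail_eq_cdf: "radial_tail x = 1 - cdf \<nu> x"
proof -
  have "{x<..} = space \<nu> - {..x}" by auto
  moreover have "measure \<nu> (space \<nu> - {..x}) = 1 - measure \<nu> {..x}"
    by (rule R.prob_compl) simp
  ultimately show ?thesis unfolding radial_tail_def cdf_def by simp
qed

end

section \<open>Rapid variation in the Gumbel domain of attraction\<close>

text \<open>
  This form treats finite and infinite endpoints alike.
\<close>

lemma eventually_increasing_to:
  assumes "r \<noteq> -\<infinity>"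
  shows "eventually Q (increasing_to r) \<longleftrightarrow> (\<exists>b. ereal b < r \<and> (\<forall>u>b. ereal u < r \<longrightarrow> Q u))"
proof (cases r)
  case (real x)
  have "(\<exists>b<x. \<forall>u>b. u < x \<longrightarrow> Q u) \<longleftrightarrow> eventually Q (at_left x)"
    by (rule eventually_at_left[of "x - 1", symmetric]) simp
  then show ?thesis by (simp add: real increasing_to_def)
next
  case PInf
  then show ?thesis by (simp add: increasing_to_def eventually_at_top_dense)
qed (use assms in auto)

lemma increasing_to_neq_bot: "increasing_to r \<noteq> bot"
  by (simp add: increasing_to_def trivial_limit_at_left_real)

lemma ereal_less_right_endpoint_iff: "ereal u < right_endpoint F \<longleftrightarrow> (\<exists>x>u. F x < 1)"
  unfolding right_endpoint_def by (auto simp: less_SUP_iff)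

text \<open>
  For an infinite endpoint, \<open>u w(u) \<rightarrow> \<infinity>\<close> means that the shift from \<open>u\<close> to \<open>c u\<close> with \<open>c > 1\<close> eventually
  exceeds \<open>x / w(u)\<close> for every fixed \<open>x\<close>, so the tail shrinks asymptotically at least by the factor \<open>exp (- x)\<close>, which is
  arbitrarily small. For a finite endpoint, \<open>b u\<close> eventually lies beyond it.
\<close>

lemma MDA_Gumbel_rapid_variation:
  assumes mda: "MDA_Gumbel F w" and pos: "0 < right_endpoint F"
    and F: "mono F" "\<And>x. F x \<le> 1" and a: "1 \<le> a" "a < b" and e: "0 < e"
  shows "\<forall>\<^sub>F u in increasing_to (right_endpoint F). 1 - F (b * u) \<le> e * (1 - F (a * u))"
proof (cases "right_endpoint F")
  case (real r)
  have F1: "F x = 1" if "r < x" for x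
  proof -
    have "\<not> F x < 1" using ereal_less_right_endpoint_iff[of r F] that by (auto simp: real)
    then show ?thesis using F(2)[of x] by simp
  qed
  have "1 < b" using a by simp
  then have "ereal (r / b) < right_endpoint F" using pos by (simp add: real field_simps)
  moreover have "1 - F (b * u) \<le> e * (1 - F (a * u))" if "r / b < u" for u
    using that F1[of "b * u"] F(2)[of "a * u"] e \<open>1 < b\<close> by (simp add: field_simps)
  ultimately show ?thesis
    using pos by (subst eventually_increasing_to) auto
next
  case PInf
  define c where "c = b / a"
  have c: "1 < c" using a by (simp add: c_def)
  \<comment> \<open>A positive shift with \<open>exp (- x) < e\<close>.\<close>
  define x where "x = max 1 (1 - ln e)"
  have x: "0 < x" "exp (- x) < e"
  proof -
    show "0 < x" by (simp add: x_def)
    have "- x < ln e" by (simp add: x_def)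
    then have "exp (- x) < exp (ln e)" by (subst exp_less_cancel_iff)
    then show "exp (- x) < e" using e by simp
  qed
  have "((\<lambda>u. (1 - F (u + x / w u)) / (1 - F u)) \<longlongrightarrow> exp (- x)) at_top"
    "filterlim (\<lambda>u. u * w u) at_top at_top"
    using mda by (auto simp: MDA_Gumbel_def increasing_to_def PInf)
  then have "\<forall>\<^sub>F u in at_top. (1 - F (u + x / w u)) / (1 - F u) < e"
    "\<forall>\<^sub>F u in at_top. max 1 (x / (c - 1)) \<le> u * w u"
    using x(2) by (auto intro: order_tendstoD simp only: filterlim_at_top)
  with eventually_gt_at_top[of "0::real"] have "\<forall>\<^sub>F u in at_top. 1 - F (c * u) \<le> e * (1 - F u)"
  proof eventually_elim
    case (elim u)
    have w: "0 < w u" using elim(1,3) zero_less_mult_pos[of u "w u"] by simp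
    have "x / (c - 1) \<le> u * w u" using elim(3) by simp
    then have "u + x / w u \<le> c * u" using w c by (simp add: field_simps)
    then have "1 - F (c * u) \<le> 1 - F (u + x / w u)" using F(1) by (simp add: monoD)
    moreover have "1 - F (u + x / w u) \<le> e * (1 - F u)"
    proof (cases "F u = 1")
      case True
      have "F u \<le> F (u + x / w u)" using F(1) w x by (simp add: monoD)
      then show ?thesis using True by simp
    next
      case False
      then have "0 < 1 - F u" using F(2)[of u] by simp
      then show ?thesis using elim(2) by (simp add: field_simps)
    qed
    ultimately show ?case by simp
  qed
  moreover have "filterlim (\<lambda>u. a * u) at_top at_top"
    using a by (intro filterlim_tendsto_pos_mult_at_top[OF tendsto_const] filterlim_ident) auto
  ultimately have "\<forall>\<^sub>F u in at_top. 1 - F (c * (a * u)) \<le> e * (1 - F (a * u))"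
    by (rule eventually_compose_filterlim)
  then show ?thesis using a by (simp add: c_def increasing_to_def PInf)
qed (use pos in auto)

section \<open>Uniform angles and orthogonal transformations\<close>

text \<open>
  An orthogonal transformation of the plane is a rotation or a rotated reflection; on the unit circle it acts
  on the angle by \<open>\<phi> \<mapsto> \<beta> \<plusminus> \<phi>\<close>.
\<close>

lemma orthogonal_transformation_plane:
  fixes T :: "real \<times> real \<Rightarrow> real \<times> real"
  assumes T: "orthogonal_transformation T"
  obtains \<beta> s where "0 \<le> \<beta>" "\<beta> < 2 * pi" "s = 1 \<or> s = -1"
    "\<And>\<phi>. T (sin \<phi>, cos \<phi>) = (sin (\<beta> + s * \<phi>), cos (\<beta> + s * \<phi>))"
proof -
  obtain a b where ab: "T (0, 1) = (a, b)" by (cases "T (0, 1)")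
  obtain x y where xy: "T (1, 0) = (x, y)" by (cases "T (1, 0)")
  have inner: "inner (T v) (T w) = inner v w" for v w
    using T unfolding orthogonal_transformation_def by blast
  have "b\<^sup>2 + a\<^sup>2 = 1" "x\<^sup>2 + y\<^sup>2 = 1" and orth: "x * a + y * b = 0"
    using inner[of "(0,1)" "(0,1)"] inner[of "(1,0)" "(1,0)"] inner[of "(1,0)" "(0,1)"]
    by (simp_all add: ab xy power2_eq_square inner_prod_def)
  then obtain \<beta> where \<beta>: "0 \<le> \<beta>" "\<beta> < 2 * pi" and b: "b = cos \<beta>" and a: "a = sin \<beta>"
    using sincos_total_2pi by metis
  define s where "s = x * cos \<beta> - y * sin \<beta>"
  have one: "sin \<beta> * sin \<beta> + cos \<beta> * cos \<beta> = 1"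
    using sin_cos_squared_add[of \<beta>] by (simp add: power2_eq_square)
  have x: "x = s * cos \<beta>" and y: "y = - s * sin \<beta>"
    using one orth unfolding s_def a b by algebra+
  have "s\<^sup>2 = 1" using \<open>x\<^sup>2 + y\<^sup>2 = 1\<close> one unfolding x y by algebra
  then have s: "s = 1 \<or> s = -1" by (simp add: power2_eq_1_iff)
  have lin: "linear T" using T by (simp add: orthogonal_transformation_def)
  have "T (sin \<phi>, cos \<phi>) = (sin (\<beta> + s * \<phi>), cos (\<beta> + s * \<phi>))" for \<phi>
  proof -
    have "T (sin \<phi>, cos \<phi>) = T (sin \<phi> *\<^sub>R (1, 0) + cos \<phi> *\<^sub>R (0, 1))" by simp
    also have "\<dots> = sin \<phi> *\<^sub>R T (1, 0) + cos \<phi> *\<^sub>R T (0, 1)"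
      using lin by (simp only: linear_add linear_scale)
    also have "\<dots> = (sin (\<beta> + s * \<phi>), cos (\<beta> + s * \<phi>))"
      using s by (auto simp: ab xy x y a b sin_add cos_add sin_diff cos_diff)
    finally show ?thesis .
  qed
  with \<beta> s show ?thesis using that by blast
qed

lemma nn_integral_periodic_affine:
  fixes H :: "real \<Rightarrow> ennreal"
  assumes [measurable]: "H \<in> borel_measurable borel" and per: "\<And>x. H (x + p) = H x"
    and t: "0 \<le> t" "t \<le> p" and s: "s = 1 \<or> s = -1"
  shows "(\<integral>\<^sup>+x\<in>{0<..<p}. H (t + s * x) \<partial>lborel) = (\<integral>\<^sup>+x\<in>{0<..<p}. H x \<partial>lborel)"
  using s
proof
  assume "s = 1"
  then have "(\<integral>\<^sup>+x\<in>{0<..<p}. H (t + s * x) \<partial>lborel) = (\<integral>\<^sup>+x\<in>{t<..<t + p}. H x \<partial>lborel)"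
    by (subst (2) nn_integral_Ioo_shift[where t=t]) (simp_all add: add.commute)
  then show ?thesis using nn_integral_periodic[of H p t] per t by simp
next
  assume "s = -1"
  have "H (t + p - x) = H (t - x)" for x
    using per[of "t - x"] by (simp add: algebra_simps)
  with \<open>s = -1\<close> have "(\<integral>\<^sup>+x\<in>{0<..<p}. H (t + s * x) \<partial>lborel) = (\<integral>\<^sup>+x\<in>{t<..<t + p}. H x \<partial>lborel)"
    by (subst (2) nn_integral_Ioo_reflect[where t="t + p"]) simp_all
  then show ?thesis using nn_integral_periodic[of H p t] per t by simp
qed

lemma borel_measurable_orthogonal_transformation:
  fixes T :: "'a::euclidean_space \<Rightarrow> 'a"
  assumes "orthogonal_transformation T"
  shows "T \<in> borel \<rightarrow>\<^sub>M borel"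
  using assms
  by (intro borel_measurable_continuous_onI linear_continuous_on linear_conv_bounded_linear[THEN iffD1] orthogonal_transformation_linear)

context polar_vector
begin

text \<open>
  For each fixed radius the transformation shifts or reflects the angle, which preserves the uniform
  distribution on the circle.
\<close>

lemma distr_law_orthogonal:
  assumes const: "AE \<phi> in lborel. \<phi> \<in> {0<..<2*pi} \<longrightarrow> q \<phi> = c"
    and T: "orthogonal_transformation T"
  shows "distr law borel T = law"
proof (rule measure_eqI)
  fix B assume "B \<in> sets (distr law borel T)"
  then have B [measurable]: "B \<in> sets (borel :: (real \<times> real) measure)" by simp
  have Tm [measurable]: "T \<in> borel \<rightarrow>\<^sub>M borel"
    using T by (rule borel_measurable_orthogonal_transformation)
  from T obtain \<beta> s where \<beta>: "0 \<le> \<beta>" "\<beta> \<le> 2 * pi" and s: "s = 1 \<or> s = -1"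
    and rot: "\<And>\<phi>. T (sin \<phi>, cos \<phi>) = (sin (\<beta> + s * \<phi>), cos (\<beta> + s * \<phi>))"
    by (metis orthogonal_transformation_plane less_imp_le)
  have rot': "T (r * sin \<phi>, r * cos \<phi>) = (r * sin (\<beta> + s * \<phi>), r * cos (\<beta> + s * \<phi>))" for r \<phi>
  proof -
    have "T (r *\<^sub>R (sin \<phi>, cos \<phi>)) = r *\<^sub>R T (sin \<phi>, cos \<phi>)"
      using T by (simp only: orthogonal_transformation_def linear_scale)
    then show ?thesis by (simp add: rot)
  qed
  have drop_q: "(\<integral>\<^sup>+\<phi>\<in>{0<..<2*pi}. (ennreal (q \<phi>) * f \<phi>) \<partial>lborel) = ennreal c * (\<integral>\<^sup>+\<phi>\<in>{0<..<2*pi}. f \<phi> \<partial>lborel)"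
    if [measurable]: "f \<in> borel_measurable borel" for f
  proof -
    have "(\<integral>\<^sup>+\<phi>\<in>{0<..<2*pi}. (ennreal (q \<phi>) * f \<phi>) \<partial>lborel) = (\<integral>\<^sup>+\<phi>. ennreal c * (f \<phi> * indicator {0<..<2*pi} \<phi>) \<partial>lborel)"
      by (rule nn_integral_cong_AE) (use const in eventually_elim, auto simp: indicator_def)
    then show ?thesis by (simp add: nn_integral_cmult)
  qed
  have "emeasure (distr law borel T) B = (\<integral>\<^sup>+x. indicator B (T x) \<partial>law)"
  proof -
    have "emeasure (distr law borel T) B = (\<integral>\<^sup>+x. indicator B x \<partial>distr law borel T)" by simp
    then show ?thesis by (subst (asm) nn_integral_distr) auto
  qed
  also have "\<dots> = (\<integral>\<^sup>+r. (\<integral>\<^sup>+\<phi>\<in>{0<..<2*pi}. (ennreal (q \<phi>) * indicator B (r * sin (\<beta> + s * \<phi>), r * cos (\<beta> + s * \<phi>))) \<partial>lborel) \<partial>\<nu>)"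
    by (subst nn_integral_law) (simp_all add: rot')
  also have "\<dots> = (\<integral>\<^sup>+r. (\<integral>\<^sup>+\<phi>\<in>{0<..<2*pi}. (ennreal (q \<phi>) * indicator B (r * sin \<phi>, r * cos \<phi>)) \<partial>lborel) \<partial>\<nu>)"
  proof (rule nn_integral_cong)
    fix r
    have m1: "(\<lambda>\<phi>. indicator B (r * sin (\<beta> + s * \<phi>), r * cos (\<beta> + s * \<phi>)) :: ennreal) \<in> borel_measurable borel"
      and m2: "(\<lambda>\<phi>. indicator B (r * sin \<phi>, r * cos \<phi>) :: ennreal) \<in> borel_measurable borel"
      by measurable
    have "(\<integral>\<^sup>+\<phi>\<in>{0<..<2*pi}. indicator B (r * sin (\<beta> + s * \<phi>), r * cos (\<beta> + s * \<phi>)) \<partial>lborel)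
      = (\<integral>\<^sup>+\<phi>\<in>{0<..<2*pi}. indicator B (r * sin \<phi>, r * cos \<phi>) \<partial>lborel)"
      by (rule nn_integral_periodic_affine[OF _ _ \<beta> s, of "\<lambda>\<phi>. indicator B (r * sin \<phi>, r * cos \<phi>)"]) auto
    then show "(\<integral>\<^sup>+\<phi>\<in>{0<..<2*pi}. (ennreal (q \<phi>) * indicator B (r * sin (\<beta> + s * \<phi>), r * cos (\<beta> + s * \<phi>))) \<partial>lborel)
      = (\<integral>\<^sup>+\<phi>\<in>{0<..<2*pi}. (ennreal (q \<phi>) * indicator B (r * sin \<phi>, r * cos \<phi>)) \<partial>lborel)"
      by (simp only: drop_q[OF m1] drop_q[OF m2])
  qed
  also have "\<dots> = emeasure law B"
    by (subst nn_integral_law[symmetric]) (simp_all)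
  finally show "emeasure (distr law borel T) B = emeasure law B" .
qed simp

text \<open>
  The linear form \<open>sin \<alpha> x + cos \<alpha> y\<close> is the first coordinate of the image under a rotation.
\<close>

lemma distr_law_direction:
  assumes inv: "\<And>T. orthogonal_transformation T \<Longrightarrow> distr law borel T = law"
  shows "distr law borel (\<lambda>x. sin \<alpha> * fst x + cos \<alpha> * snd x) = distr law borel fst"
proof -
  define T :: "real \<times> real \<Rightarrow> real \<times> real"
    where "T x = (sin \<alpha> * fst x + cos \<alpha> * snd x, - cos \<alpha> * fst x + sin \<alpha> * snd x)" for x
  have one: "sin \<alpha> * sin \<alpha> + cos \<alpha> * cos \<alpha> = 1"
    using sin_cos_squared_add[of \<alpha>] by (simp add: power2_eq_square)
  have "linear T"
    by (rule linearI) (auto simp: T_def algebra_simps)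
  moreover have "inner (T v) (T w) = inner v w" for v w
    unfolding T_def inner_prod_def inner_real_def fst_conv snd_conv using one by algebra
  ultimately have T: "orthogonal_transformation T"
    by (simp add: orthogonal_transformation_def)
  have [measurable]: "T \<in> borel \<rightarrow>\<^sub>M borel" using T by (rule borel_measurable_orthogonal_transformation)
  have [measurable]: "fst \<in> borel_measurable (borel :: (real \<times> real) measure)"
    unfolding borel_prod[symmetric] by measurable
  have "distr law borel fst = distr (distr law borel T) borel fst" by (simp add: inv[OF T])
  also have "\<dots> = distr law borel (\<lambda>x. sin \<alpha> * fst x + cos \<alpha> * snd x)"
    by (subst distr_distr) (auto simp: T_def comp_def)
  finally show ?thesis ..
qed

text \<open>
  By Fubini, for almost every radius \<open>r\<close> almost all angles satisfy \<open>r sin \<phi> \<notin> A\<close>, because \<open>q\<close> is a positive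
  constant. Some such \<open>r\<close> exceeds \<open>v\<close>, and the substitution \<open>s = r sin \<phi>\<close> turns this into a statement about
  Lebesgue measure on \<open>(0, r)\<close>.
\<close>

lemma null_sets_of_first_coordinate:
  assumes const: "AE \<phi> in lborel. \<phi> \<in> {0<..<2*pi} \<longrightarrow> q \<phi> = c"
    and A [measurable]: "A \<in> sets borel" and null: "emeasure law {x. fst x \<in> A} = 0"
    and v: "0 < v" "0 < radial_tail v"
  shows "emeasure lborel (A \<inter> {0<..<v}) = 0"
proof -
  have c: "0 < c"
  proof (rule ccontr)
    assume "\<not> 0 < c"
    then have "(\<integral>\<^sup>+\<phi>\<in>{0<..<2*pi}. ennreal (q \<phi>) \<partial>lborel) = (\<integral>\<^sup>+\<phi>. 0 \<partial>(lborel :: real measure))"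
      by (intro nn_integral_cong_AE)
         (use const in eventually_elim, auto simp: indicator_def ennreal_eq_0_iff)
    then show False using q_total by simp
  qed
  have [measurable]: "fst \<in> borel_measurable (borel :: (real \<times> real) measure)"
    unfolding borel_prod[symmetric] by measurable
  have mA: "{x. fst x \<in> A} \<in> sets (borel :: (real \<times> real) measure)"
    using measurable_sets[of fst borel borel A] by (simp add: vimage_def)
  have "emeasure law {x. fst x \<in> A} = (\<integral>\<^sup>+x. indicator A (fst x) \<partial>law)"
  proof -
    have "emeasure law {x. fst x \<in> A} = (\<integral>\<^sup>+x. indicator {x. fst x \<in> A} x \<partial>law)" using mA by simp
    then show ?thesis by (simp add: indicator_def)
  qed
  also have "\<dots> = (\<integral>\<^sup>+r. (\<integral>\<^sup>+\<phi>\<in>{0<..<2*pi}. (ennreal (q \<phi>) * indicator A (r * sin \<phi>)) \<partial>lborel) \<partial>\<nu>)"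
    by (subst nn_integral_law) simp_all
  finally have "AE r in \<nu>. (\<integral>\<^sup>+\<phi>\<in>{0<..<2*pi}. (ennreal (q \<phi>) * indicator A (r * sin \<phi>)) \<partial>lborel) = 0"
    using null by (subst nn_integral_0_iff_AE[symmetric]) auto
  moreover have "\<not> (AE r in \<nu>. r \<notin> {v<..})"
    using v(2) by (subst AE_iff_measurable[OF _ refl]) (auto simp: radial_tail_def R.emeasure_eq_measure greaterThan_def)
  ultimately obtain r where r: "v < r"
    and z: "(\<integral>\<^sup>+\<phi>\<in>{0<..<2*pi}. (ennreal (q \<phi>) * indicator A (r * sin \<phi>)) \<partial>lborel) = 0"
    by (smt (verit) eventually_mono greaterThan_iff)
  have r0: "0 < r" using r v by simp
  from z have "AE \<phi> in lborel. ennreal (q \<phi>) * indicator A (r * sin \<phi>) * indicator {0<..<2*pi} \<phi> = 0"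
    by (subst (asm) nn_integral_0_iff_AE) auto
  with const have "AE \<phi> in lborel. indicator A (r * sin \<phi>) * ennreal (cos \<phi>) * indicator {0<..<pi/2} \<phi> = 0"
    by eventually_elim (use c pi_gt_zero in \<open>auto simp: indicator_def split: if_splits\<close>)
  then have "(\<integral>\<^sup>+\<phi>\<in>{0<..<pi/2}. (indicator A (r * sin \<phi>) * ennreal (cos \<phi>)) \<partial>lborel) = 0"
    by (subst nn_integral_0_iff_AE) auto
  then have "(\<integral>\<^sup>+s\<in>{0<..<1}. indicator A (r * s) \<partial>lborel) = 0"
    by (subst nn_integral_sin_substitution) auto
  moreover have "(\<integral>\<^sup>+x. indicator (A \<inter> {0<..<r}) x \<partial>lborel) = ennreal r * (\<integral>\<^sup>+s\<in>{0<..<1}. indicator A (r * s) \<partial>lborel)"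
    using r0 by (subst nn_integral_real_affine[where c=r and t=0])
      (auto intro!: arg_cong2[where f="(*)"] nn_integral_cong simp: indicator_def field_simps zero_less_mult_iff)
  ultimately have "emeasure lborel (A \<inter> {0<..<r}) = 0" by simp
  then show ?thesis
    using r by (intro emeasure_eq_0[OF _ \<open>emeasure lborel (A \<inter> {0<..<r}) = 0\<close>]) auto
qed

end

section \<open>Asymptotically equivalent densities\<close>

text \<open>
  A quotient \<open>f / h\<close> within \<open>e < 1\<close> of \<open>1\<close> entails \<open>(1 - e) h \<le> f \<le> (1 + e) h\<close>, which survives integration
  over \<open>(u, r)\<close>; beyond \<open>r\<close> both variables carry no mass. It also entails \<open>h > 0\<close>, as the quotient is \<open>0\<close> where
  \<open>h\<close> vanishes; this keeps the tail of \<open>Y\<close> positive.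
\<close>

lemma tail_equiv_of_density_tail_equiv:
  assumes "prob_space N" and f: "has_real_density N X f" and h: "has_real_density N Y h"
    and de: "density_tail_equiv r f h" and r: "0 < r"
    and X0: "\<And>v. r = ereal v \<Longrightarrow> measure N {\<omega> \<in> space N. v < X \<omega>} = 0"
    and Y0: "\<And>v. r = ereal v \<Longrightarrow> measure N {\<omega> \<in> space N. v < Y \<omega>} = 0"
  shows "tail_equiv r (\<lambda>u. measure N {\<omega> \<in> space N. X \<omega> > u}) (\<lambda>u. measure N {\<omega> \<in> space N. Y \<omega> > u})"
proof -
  interpret N: prob_space N by fact
  have tail: "ennreal (measure N {\<omega> \<in> space N. Z \<omega> > u}) = (\<integral>\<^sup>+x. ennreal (k x) * indicator {x. u < x \<and> ereal x < r} x \<partial>lborel)"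
    (is "_ = ?R")
    if k: "has_real_density N Z k" and Z0: "\<And>v. r = ereal v \<Longrightarrow> measure N {\<omega> \<in> space N. v < Z \<omega>} = 0"
      and u: "ereal u < r" for Z k u
  proof -
    have D: "distributed N lborel Z (\<lambda>x. ennreal (k x))" using k by (simp add: has_real_density_def)
    then have [measurable]: "(\<lambda>x. ennreal (k x)) \<in> borel_measurable borel" by (auto simp: distributed_def)
    have em: "emeasure N {\<omega> \<in> space N. Z \<omega> > v} = (\<integral>\<^sup>+x. ennreal (k x) * indicator {v<..} x \<partial>lborel)" for v
    proof -
      have "emeasure N (Z -` {v<..} \<inter> space N) = (\<integral>\<^sup>+x. ennreal (k x) * indicator {v<..} x \<partial>lborel)"
        by (rule distributed_emeasure[OF D]) auto
      moreover have "Z -` {v<..} \<inter> space N = {\<omega> \<in> space N. Z \<omega> > v}" by auto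
      ultimately show ?thesis by simp
    qed
    have beyond: "AE x in lborel. ereal x \<ge> r \<longrightarrow> ennreal (k x) = 0"
    proof (cases r)
      case (real v)
      have "(\<integral>\<^sup>+x. ennreal (k x) * indicator {v<..} x \<partial>lborel) = 0"
        using Z0[OF real] em[of v] by (simp add: N.emeasure_eq_measure)
      then have "AE x in lborel. ennreal (k x) * indicator {v<..} x = 0"
        by (subst (asm) nn_integral_0_iff_AE) auto
      then show ?thesis using AE_lborel_singleton[of v]
        by eventually_elim (auto simp: real indicator_def split: if_splits)
    qed (use r in auto)
    have "emeasure N {\<omega> \<in> space N. Z \<omega> > u} = ?R"
      unfolding em
      by (rule nn_integral_cong_AE) (use beyond in eventually_elim, auto simp: indicator_def not_less)
    then show ?thesis by (simp add: N.emeasure_eq_measure)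
  qed
  have [measurable]: "(\<lambda>x. ennreal (f x)) \<in> borel_measurable borel" "(\<lambda>x. ennreal (h x)) \<in> borel_measurable borel"
    using f h by (auto simp: has_real_density_def distributed_def)
  have [measurable]: "{x. u < x \<and> ereal x < r} \<in> sets borel" for u
  proof -
    have "Measurable.pred borel (\<lambda>x. u < x \<and> ereal x < r)" by measurable
    then show ?thesis by (simp add: pred_def)
  qed
  have f0: "0 \<le> f x" and h0: "0 \<le> h x" for x
    using f h by (auto simp: has_real_density_def)
  let ?P = "\<lambda>u. measure N {\<omega> \<in> space N. X \<omega> > u}" and ?Q = "\<lambda>u. measure N {\<omega> \<in> space N. Y \<omega> > u}"
  have key: "\<forall>\<^sub>F u in increasing_to r. dist (?P u / ?Q u) 1 \<le> e" if e: "0 < e" "e < 1" for e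
  proof -
    have "\<forall>\<^sub>F u in inf (increasing_to r) (ae_filter lborel). dist (f u / h u) 1 < e"
      using de e by (simp add: density_tail_equiv_def tendstoD)
    then obtain A B where A: "eventually A (increasing_to r)" and B: "AE u in lborel. B u"
      and AB: "\<And>u. A u \<Longrightarrow> B u \<Longrightarrow> dist (f u / h u) 1 < e"
      unfolding eventually_inf by blast
    from A obtain b where b: "ereal b < r" and bA: "\<And>u. b < u \<Longrightarrow> ereal u < r \<Longrightarrow> A u"
      using r by (subst (asm) eventually_increasing_to) auto
    have close: "AE x in lborel. b < x \<and> ereal x < r \<longrightarrow> 0 < h x \<and> f x \<le> (1 + e) * h x \<and> (1 - e) * h x \<le> f x"
      using B
    proof eventually_elim
      case (elim x)
      show ?case
      proof
        assume "b < x \<and> ereal x < r"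
        then have d: "\<bar>f x / h x - 1\<bar> < e" using AB bA elim by (auto simp: dist_real_def)
        then have "h x \<noteq> 0" using e by auto
        then have "0 < h x" using h0[of x] by simp
        moreover have "1 - e < f x / h x" "f x / h x < 1 + e" using d by (auto simp: abs_less_iff)
        ultimately show "0 < h x \<and> f x \<le> (1 + e) * h x \<and> (1 - e) * h x \<le> f x"
          by (auto simp: field_simps)
      qed
    qed
    have "dist (?P u / ?Q u) 1 \<le> e" if u: "b < u" "ereal u < r" for u
    proof -
      let ?J = "{x. u < x \<and> ereal x < r}"
      have P: "ennreal (?P u) = (\<integral>\<^sup>+x. ennreal (f x) * indicator ?J x \<partial>lborel)"
        using f X0 u(2) by (rule tail)
      have Q: "ennreal (?Q u) = (\<integral>\<^sup>+x. ennreal (h x) * indicator ?J x \<partial>lborel)"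
        using h Y0 u(2) by (rule tail)
      have "ennreal (?P u) \<le> (\<integral>\<^sup>+x. ennreal (1 + e) * (ennreal (h x) * indicator ?J x) \<partial>lborel)"
        unfolding P
      proof (rule nn_integral_mono_AE, use close in eventually_elim)
        case (elim x)
        show ?case
        proof (cases "x \<in> ?J")
          case True
          then have "ennreal (f x) \<le> ennreal ((1 + e) * h x)" using elim u by (intro ennreal_leI) auto
          also have "\<dots> = ennreal (1 + e) * ennreal (h x)" using e h0 by (intro ennreal_mult) auto
          finally show ?thesis using True by simp
        qed simp
      qed
      also have "\<dots> = ennreal ((1 + e) * ?Q u)"
        using e by (simp add: nn_integral_cmult Q ennreal_mult)
      finally have upper: "?P u \<le> (1 + e) * ?Q u"
        using e by (subst (asm) ennreal_le_iff) auto
      have "ennreal ((1 - e) * ?Q u) = (\<integral>\<^sup>+x. ennreal (1 - e) * (ennreal (h x) * indicator ?J x) \<partial>lborel)"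
        using e by (simp add: nn_integral_cmult Q ennreal_mult)
      also have "\<dots> \<le> ennreal (?P u)"
        unfolding P
      proof (rule nn_integral_mono_AE, use close in eventually_elim)
        case (elim x)
        show ?case
        proof (cases "x \<in> ?J")
          case True
          have "ennreal (1 - e) * ennreal (h x) = ennreal ((1 - e) * h x)"
            using e h0 by (intro ennreal_mult[symmetric]) auto
          also have "\<dots> \<le> ennreal (f x)" using True elim u by (intro ennreal_leI) auto
          finally show ?thesis using True by simp
        qed simp
      qed
      finally have lower: "(1 - e) * ?Q u \<le> ?P u" by simp
      have "?Q u \<noteq> 0"
      proof
        assume "?Q u = 0"
        then have "(\<integral>\<^sup>+x. ennreal (h x) * indicator ?J x \<partial>lborel) = 0" using Q by simp
        then have "AE x in lborel. ennreal (h x) * indicator ?J x = 0"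
          by (subst (asm) nn_integral_0_iff_AE) auto
        with close have nJ: "AE x in lborel. x \<notin> ?J"
          by eventually_elim (use u in \<open>auto simp: indicator_def ennreal_eq_0_iff\<close>)
        obtain v where v: "u < v" "ereal v < r"
          using ereal_dense2[OF u(2)] by auto
        then have "{u<..<v} \<subseteq> ?J" by (auto intro: less_trans[of _ "ereal v" r])
        with nJ have "AE x in lborel. x \<notin> {u<..<v}" by (auto elim!: eventually_mono)
        then have "emeasure lborel {u<..<v} = 0"
          by (subst (asm) AE_iff_measurable[OF _ refl]) (auto simp: greaterThanLessThan_def greaterThan_def lessThan_def Collect_conj_eq)
        then show False using v by simp
      qed
      then have "0 < ?Q u" by (simp add: less_le)
      then have "1 - e \<le> ?P u / ?Q u" "?P u / ?Q u \<le> 1 + e"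
        using upper lower by (simp_all add: field_simps)
      then show ?thesis by (simp add: dist_real_def abs_le_iff)
    qed
    then show ?thesis using r b by (subst eventually_increasing_to) auto
  qed
  show ?thesis
    unfolding tail_equiv_def
  proof (rule tendstoI)
    fix e :: real assume "0 < e"
    then have "\<forall>\<^sub>F u in increasing_to r. dist (?P u / ?Q u) 1 \<le> min (e/2) (1/2)"
      by (intro key) auto
    then show "\<forall>\<^sub>F u in increasing_to r. dist (?P u / ?Q u) 1 < e"
      by eventually_elim (use \<open>0 < e\<close> in auto)
  qed
qed

lemma has_real_density_unique_AE:
  assumes "has_real_density N X f" "has_real_density N Y h" and "distr N borel X = distr N borel Y"
  shows "AE x in lborel. f x = h x"
proof -
  have "distr N lborel X = distr N lborel Y"
    using assms(3) by (metis distr_cong sets_lborel)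
  then have "density lborel (\<lambda>x. ennreal (f x)) = density lborel (\<lambda>x. ennreal (h x))"
    using assms(1,2) by (simp add: has_real_density_def distributed_def)
  then have "AE x in lborel. ennreal (f x) = ennreal (h x)"
    using assms(1,2) by (subst (asm) sigma_finite_measure.density_unique_iff[OF sigma_finite_lborel]) (auto simp: has_real_density_def distributed_def)
  then show ?thesis
    by eventually_elim (use assms(1,2) in \<open>auto simp: has_real_density_def\<close>)
qed

section \<open>The characterisation of spherical vectors\<close>

text \<open>
  The last assumption stands for the symmetry of the vector under reflections in the axes: a constant value of
  \<open>q\<close> on the first quadrant carries over to the whole circle.
\<close>

locale gumbel_polar_vector = polar_vector \<nu> q for \<nu> q +
  fixes w :: "real \<Rightarrow> real"
  assumes mda: "MDA_Gumbel (cdf \<nu>) w" and endpoint_pos: "0 < right_endpoint (cdf \<nu>)"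
    and q_cont: "\<And>\<alpha>. \<alpha> \<in> {0<..<pi/2} \<Longrightarrow> isCont q \<alpha>"
    and q_symmetric: "\<And>c. (\<And>\<theta>. \<theta> \<in> {0<..<pi/2} \<Longrightarrow> q \<theta> = c) \<Longrightarrow> AE \<phi> in lborel. q \<phi> = c"
begin

abbreviation endpoint :: ereal where
  "endpoint \<equiv> right_endpoint (cdf \<nu>)"

lemma cdf_mono_nu: "mono (cdf \<nu>)" and cdf_nu_le_1: "cdf \<nu> x \<le> 1"
proof -
  interpret real_distribution \<nu> by unfold_locales auto
  show "mono (cdf \<nu>)" by (auto simp: mono_def cdf_nondecreasing)
  show "cdf \<nu> x \<le> 1" by (simp add: cdf_bounded_prob)
qed

lemma radial_tail_pos: "ereal u < endpoint \<Longrightarrow> 0 < radial_tail u"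
  and radial_tail_pos_beyond: "ereal u < endpoint \<Longrightarrow> \<exists>v>u. ereal v < endpoint \<and> 0 < radial_tail v"
proof -
  show *: "0 < radial_tail u" if u: "ereal u < endpoint" for u
  proof -
    obtain x where "u < x" "cdf \<nu> x < 1" using u unfolding ereal_less_right_endpoint_iff by auto
    moreover have "cdf \<nu> u \<le> cdf \<nu> x" using cdf_mono_nu \<open>u < x\<close> by (simp add: monoD)
    ultimately show ?thesis by (simp add: radial_tail_eq_cdf)
  qed
  assume "ereal u < endpoint"
  then obtain v where "u < v" "ereal v < endpoint" using ereal_dense2 by force
  then show "\<exists>v>u. ereal v < endpoint \<and> 0 < radial_tail v" using * by auto
qed

lemma eventually_in_range: "\<forall>\<^sub>F u in increasing_to endpoint. 0 < u \<and> ereal u < endpoint"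
proof -
  have "endpoint \<noteq> -\<infinity>" "ereal 0 < endpoint" using endpoint_pos by (auto simp: zero_ereal_def)
  then show ?thesis by (subst eventually_increasing_to) auto
qed

lemma radial_tail_rapid:
  assumes "0 < \<delta>" "\<delta> < pi / 2" "0 < e"
  shows "\<forall>\<^sub>F u in increasing_to endpoint. radial_tail (u / cos \<delta>) \<le> e * radial_tail (u / cos (\<delta> / 2))"
proof -
  have "0 < cos \<delta>" using assms by (intro cos_gt_zero) auto
  moreover have "cos \<delta> < cos (\<delta> / 2)" using assms by (intro cos_monotone_0_pi) auto
  moreover have "cos (\<delta> / 2) \<le> 1" by simp
  ultimately have "1 \<le> 1 / cos (\<delta> / 2)" "1 / cos (\<delta> / 2) < 1 / cos \<delta>"
    by (auto simp: field_simps)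
  from MDA_Gumbel_rapid_variation[OF mda endpoint_pos cdf_mono_nu cdf_nu_le_1 this assms(3)]
  show ?thesis by (simp add: radial_tail_eq_cdf)
qed

lemma exists_direction_pos: "\<exists>\<alpha>\<in>{0<..<pi/2}. 0 < q \<alpha>"
proof (rule ccontr)
  assume "\<not> ?thesis"
  then have "AE \<phi> in lborel. q \<phi> = 0"
    by (intro q_symmetric) (metis less_le q_nonneg)
  then have "(\<integral>\<^sup>+\<phi>\<in>{0<..<2*pi}. ennreal (q \<phi>) \<partial>lborel) = (\<integral>\<^sup>+\<phi>. 0 \<partial>(lborel :: real measure))"
    by (intro nn_integral_cong_AE) (auto elim: eventually_mono)
  then show False using q_total by simp
qed

text \<open>
  The radius has no mass beyond the endpoint, since its distribution function is right-continuous, and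
  \<open>R cos (\<phi> - \<alpha>) \<le> R\<close>.
\<close>

lemma directional_tail_zero_beyond:
  assumes "endpoint = ereal v"
  shows "directional_tail \<alpha> v = 0"
proof -
  have v: "0 < v" using endpoint_pos assms by simp
  have "radial_tail v = 0"
  proof -
    interpret real_distribution \<nu> by unfold_locales auto
    have F1: "cdf \<nu> x = 1" if "v < x" for x
    proof -
      have "\<not> cdf \<nu> x < 1" using assms that ereal_less_right_endpoint_iff[of v "cdf \<nu>"] by (auto simp:)
      then show ?thesis using cdf_nu_le_1[of x] by simp
    qed
    have "(cdf \<nu> \<longlongrightarrow> cdf \<nu> v) (at_right v)"
      using cdf_is_right_cont[of v] by (simp add: continuous_within)
    moreover have "(cdf \<nu> \<longlongrightarrow> 1) (at_right v)"
      by (rule tendsto_eventually) (use F1 in \<open>auto simp: eventually_at_right_less eventually_at_filter\<close>)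
    ultimately have "cdf \<nu> v = 1" by (intro tendsto_unique[OF trivial_limit_at_right_real])
    then show ?thesis by (simp add: radial_tail_eq_cdf)
  qed
  then have z: "emeasure \<nu> {v<..} = 0" by (simp add: radial_tail_def R.emeasure_eq_measure)
  have "emeasure \<nu> {r. v < r * cos (\<phi> - \<alpha>)} = 0" for \<phi>
  proof -
    have "AE r in \<nu>. r \<in> {r. v < r * cos (\<phi> - \<alpha>)} \<longrightarrow> r \<in> {v<..}"
      using R_pos
    proof eventually_elim
      case (elim r)
      then have "r * cos (\<phi> - \<alpha>) \<le> r" by (simp add: mult_left_le)
      then show ?case by auto
    qed
    then have "emeasure \<nu> {r. v < r * cos (\<phi> - \<alpha>)} \<le> emeasure \<nu> {v<..}"
      by (intro emeasure_mono_AE) auto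
    then show ?thesis using z by simp
  qed
  then have "ennreal (directional_tail \<alpha> v) = 0" by (simp add: ennreal_directional_tail)
  then show ?thesis by (simp add: ennreal_eq_0_iff antisym)
qed

text \<open>
  Two directions that are both equivalent to the first axis are equivalent to each other, so their angular
  densities agree.
\<close>

lemma angular_density_const:
  assumes eq: "\<And>\<alpha>. \<alpha> \<in> {0<..<pi/2} \<Longrightarrow> tail_equiv endpoint (directional_tail \<alpha>) (directional_tail (pi/2))"
  shows "\<exists>c. AE \<phi> in lborel. q \<phi> = c"
proof -
  have le: "q \<beta> \<le> q \<alpha>" if \<alpha>: "\<alpha> \<in> {0<..<pi/2}" and \<beta>: "\<beta> \<in> {0<..<pi/2}" for \<alpha> \<beta>
  proof (rule angular_density_mono_of_ratio[OF increasing_to_neq_bot _ radial_tail_rapid \<alpha> q_cont[OF \<alpha>] \<beta> q_cont[OF \<beta>]])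
    show "\<forall>\<^sub>F u in increasing_to endpoint. 0 < u" using eventually_in_range by eventually_elim simp
    let ?A = "directional_tail \<alpha>" and ?B = "directional_tail \<beta>" and ?C = "directional_tail (pi/2)"
    have A: "((\<lambda>u. ?A u / ?C u) \<longlongrightarrow> 1) (increasing_to endpoint)" and B: "((\<lambda>u. ?B u / ?C u) \<longlongrightarrow> 1) (increasing_to endpoint)"
      using eq[OF \<alpha>] eq[OF \<beta>] by (simp_all add: tail_equiv_def)
    have "\<forall>\<^sub>F u in increasing_to endpoint. 0 < ?A u / ?C u" by (rule order_tendstoD(1)[OF A]) simp
    \<comment> \<open>Positivity of the quotient rules out \<open>?C u = 0\<close>, where it would be \<open>0\<close>.\<close>
    then have ev: "\<forall>\<^sub>F u in increasing_to endpoint. (?A u / ?C u) / (?B u / ?C u) = ?A u / ?B u"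
      by eventually_elim auto
    have "((\<lambda>u. (?A u / ?C u) / (?B u / ?C u)) \<longlongrightarrow> 1 / 1) (increasing_to endpoint)"
      by (intro tendsto_divide A B) simp
    from Lim_transform_eventually[OF this ev] show "((\<lambda>u. ?A u / ?B u) \<longlongrightarrow> 1) (increasing_to endpoint)"
      by simp
  qed
  have "pi / 4 \<in> {0<..<pi/2}" by simp
  then have "AE \<phi> in lborel. q \<phi> = q (pi / 4)"
    by (intro q_symmetric antisym le)
  then show ?thesis ..
qed

definition law_invariant :: bool where
  "law_invariant \<longleftrightarrow> (\<forall>T. orthogonal_transformation T \<longrightarrow> distr law borel T = law)"

lemma law_invariant_of_tail_equiv:
  assumes eq: "\<And>\<alpha>. \<alpha> \<in> {0<..<pi/2} \<Longrightarrow> tail_equiv endpoint (directional_tail \<alpha>) (directional_tail (pi/2))"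
  shows law_invariant
proof -
  obtain c where "AE \<phi> in lborel. q \<phi> = c" using angular_density_const[OF eq] by blast
  then have "AE \<phi> in lborel. \<phi> \<in> {0<..<2*pi} \<longrightarrow> q \<phi> = c" by eventually_elim simp
  then show ?thesis unfolding law_invariant_def by (blast intro: distr_law_orthogonal)
qed

lemma directional_tail_eq_of_invariant:
  assumes law_invariant
  shows "directional_tail \<alpha> u = directional_tail \<beta> u"
proof -
  have *: "directional_tail \<alpha> u = measure (distr law borel fst) {u<..}" for \<alpha>
  proof -
    have "(\<lambda>x. sin \<alpha> * fst x + cos \<alpha> * snd x) \<in> borel_measurable (borel :: (real \<times> real) measure)"
      by (intro borel_measurable_continuous_onI continuous_intros)
    then have "directional_tail \<alpha> u = measure (distr law borel (\<lambda>x. sin \<alpha> * fst x + cos \<alpha> * snd x)) {u<..}"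
      by (subst measure_distr) (auto simp: directional_tail_def vimage_def)
    then show ?thesis
      using assms distr_law_direction[of \<alpha>] by (simp add: law_invariant_def)
  qed
  show ?thesis by (simp add: *)
qed

text \<open>
  All directions have the same tail; it is positive because it is so in a direction where \<open>q\<close> does not vanish.
\<close>

lemma tail_equiv_of_invariant:
  assumes law_invariant
  shows "tail_equiv endpoint (directional_tail \<alpha>) (directional_tail \<beta>)"
  unfolding tail_equiv_def
proof (rule tendsto_eventually)
  obtain \<alpha>0 where \<alpha>0: "\<alpha>0 \<in> {0<..<pi/2}" "0 < q \<alpha>0" using exists_direction_pos by auto
  show "\<forall>\<^sub>F u in increasing_to endpoint. directional_tail \<alpha> u / directional_tail \<beta> u = 1"
    using eventually_in_range
  proof eventually_elim
    case (elim u)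
    then obtain v where "u < v" "0 < radial_tail v" using radial_tail_pos_beyond by blast
    then have "0 < directional_tail \<alpha>0 u"
      using \<alpha>0 elim by (intro directional_tail_pos q_cont) auto
    then show ?case
      using directional_tail_eq_of_invariant[OF assms, of \<alpha> u \<alpha>0] directional_tail_eq_of_invariant[OF assms, of \<beta> u \<alpha>0]
      by simp
  qed
qed

text \<open>
  The zero set \<open>A\<close> of \<open>h\<close> is avoided by the first coordinate, so \<open>A \<inter> (0, k)\<close> is a null set for each \<open>k\<close>
  below the endpoint. Rational \<open>k\<close> exhaust the range.
\<close>

lemma AE_first_density_pos:
  assumes inv: law_invariant and h: "h \<in> borel_measurable borel" "\<And>x. 0 \<le> h x"
    and dens: "distr law borel fst = density lborel (\<lambda>x. ennreal (h x))"
  shows "AE x in lborel. 0 < x \<and> ereal x < endpoint \<longrightarrow> 0 < h x"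
proof -
  note h(1) [measurable]
  have [measurable]: "fst \<in> borel_measurable (borel :: (real \<times> real) measure)"
    unfolding borel_prod[symmetric] by measurable
  obtain c where "AE \<phi> in lborel. q \<phi> = c"
    using angular_density_const tail_equiv_of_invariant[OF inv] by blast
  then have const: "AE \<phi> in lborel. \<phi> \<in> {0<..<2*pi} \<longrightarrow> q \<phi> = c" by eventually_elim simp
  define A where "A = {x. h x = 0}"
  have A [measurable]: "A \<in> sets borel" unfolding A_def by measurable
  have "emeasure law {x. fst x \<in> A} = emeasure (distr law borel fst) A"
    by (subst emeasure_distr) (auto simp: vimage_def)
  also have "\<dots> = (\<integral>\<^sup>+x. ennreal (h x) * indicator A x \<partial>lborel)"
    unfolding dens by (subst emeasure_density) auto
  also have "\<dots> = (\<integral>\<^sup>+x. 0 \<partial>(lborel :: real measure))"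
    by (intro nn_integral_cong) (auto simp: A_def indicator_def)
  finally have null: "emeasure law {x. fst x \<in> A} = 0" by simp
  have "AE x in lborel. \<forall>k\<in>\<rat>. 0 < k \<and> ereal k < endpoint \<longrightarrow> \<not> (x \<in> A \<inter> {0<..<k})"
  proof (subst AE_ball_countable[OF countable_rat], intro ballI)
    fix k :: real
    show "AE x in lborel. 0 < k \<and> ereal k < endpoint \<longrightarrow> \<not> (x \<in> A \<inter> {0<..<k})"
    proof (cases "0 < k \<and> ereal k < endpoint")
      case True
      then have "emeasure lborel (A \<inter> {0<..<k}) = 0"
        by (intro null_sets_of_first_coordinate[OF const A null] radial_tail_pos) auto
      then have "A \<inter> {0<..<k} \<in> null_sets lborel" by (intro null_setsI) auto
      from AE_not_in[OF this] show ?thesis by eventually_elim simp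
    next
      case False
      then show ?thesis by (intro AE_I2) auto
    qed
  qed
  then show ?thesis
  proof eventually_elim
    case (elim x)
    show ?case
    proof
      assume x: "0 < x \<and> ereal x < endpoint"
      then obtain v where "x < v" "ereal v < endpoint" using radial_tail_pos_beyond by blast
      moreover from Rats_dense_in_real[OF \<open>x < v\<close>] obtain k where "k \<in> \<rat>" "x < k" "k < v" by blast
      ultimately have "x \<notin> A"
        using elim x by (auto dest!: bspec[of _ _ k] intro: less_trans[of _ "ereal v"])
      then show "0 < h x" using h(2)[of x] by (simp add: A_def)
    qed
  qed
qed

end

theorem theorem4p3:
  fixes M :: "'a measure" and N :: "'b measure"
    and R S I\<^sub>1 I\<^sub>2 :: "'a \<Rightarrow> real" and U\<^sub>1 U\<^sub>2 :: "'b \<Rightarrow> real"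
    and F g w :: "real \<Rightarrow> real"
  assumes "prob_space M" and "prob_space N"
    and "prob_space.indep_vars M (\<lambda>_. borel) (\<lambda>i. [R, S, I\<^sub>1, I\<^sub>2] ! i) {..<4}"
    and "AE \<omega> in M. 0 < R \<omega>" and "F = cdf (distr M borel R)"
    and "AE \<omega> in M. S \<omega> \<in> {0<..<1}"
    and "has_real_density M S g" and "continuous_on {0<..<1} g"
    and "measure M {\<omega> \<in> space M. I\<^sub>1 \<omega> = 1} = 1 / 2"
    and "measure M {\<omega> \<in> space M. I\<^sub>1 \<omega> = -1} = 1 / 2"
    and "measure M {\<omega> \<in> space M. I\<^sub>2 \<omega> = 1} = 1 / 2"
    and "measure M {\<omega> \<in> space M. I\<^sub>2 \<omega> = -1} = 1 / 2"
    and "U\<^sub>1 \<in> borel_measurable N" and "U\<^sub>2 \<in> borel_measurable N"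
    and "distr N borel (\<lambda>\<omega>. (U\<^sub>1 \<omega>, U\<^sub>2 \<omega>)) =
         distr M borel (\<lambda>\<omega>. R \<omega> *\<^sub>R (I\<^sub>1 \<omega> * S \<omega>, I\<^sub>2 \<omega> * sqrt (1 - (S \<omega>)\<^sup>2)))"
    and "0 < right_endpoint F" and "MDA_Gumbel F w"
  shows "((\<forall>\<rho>\<in>{0<..<1}.
             tail_equiv (right_endpoint F)
               (\<lambda>u. measure N {\<omega> \<in> space N. combination U\<^sub>1 U\<^sub>2 \<rho> \<omega> > u})
               (\<lambda>u. measure N {\<omega> \<in> space N. U\<^sub>1 \<omega> > u}))
          \<longleftrightarrow> spherical N (\<lambda>\<omega>. (U\<^sub>1 \<omega>, U\<^sub>2 \<omega>)))
       \<and> (\<forall>h :: real \<Rightarrow> real \<Rightarrow> real.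
            (\<forall>\<rho>\<in>{0<..<1}. has_real_density N (combination U\<^sub>1 U\<^sub>2 \<rho>) (h \<rho>)) \<and>
            has_real_density N U\<^sub>1 (h 1) \<longrightarrow>
              ((\<forall>\<rho>\<in>{0<..<1}. density_tail_equiv (right_endpoint F) (h \<rho>) (h 1))
               \<longleftrightarrow> spherical N (\<lambda>\<omega>. (U\<^sub>1 \<omega>, U\<^sub>2 \<omega>))))"
proof -
  let ?\<nu> = "distr M borel R" and ?q = "folded_density g"
  note polar = law_signed_polar[OF assms(1,3,4,6,7,9-12)]
  interpret V: gumbel_polar_vector ?\<nu> ?q w
  proof (intro gumbel_polar_vector.intro polar(1) gumbel_polar_vector_axioms.intro)
    show "MDA_Gumbel (cdf ?\<nu>) w" "0 < right_endpoint (cdf ?\<nu>)"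
      using assms(5,16,17) by simp_all
  qed (use assms(8) in \<open>auto intro: isCont_folded_density AE_folded_density_eq\<close>)
  let ?r = "right_endpoint F"
  have r: "right_endpoint (cdf ?\<nu>) = ?r" by (simp add: assms(5))
  note [measurable] = assms(13,14)
  have law: "distr N borel (\<lambda>\<omega>. (U\<^sub>1 \<omega>, U\<^sub>2 \<omega>)) = V.law"
    using assms(15) polar(2) by simp
  have push: "distr N borel (\<lambda>\<omega>. f (U\<^sub>1 \<omega>, U\<^sub>2 \<omega>)) = distr V.law borel f"
    if [measurable]: "f \<in> borel \<rightarrow>\<^sub>M borel" for f :: "real \<times> real \<Rightarrow> 'c::topological_space"
    unfolding law[symmetric] by (subst distr_distr) (auto simp: comp_def)
  have spherical_iff: "spherical N (\<lambda>\<omega>. (U\<^sub>1 \<omega>, U\<^sub>2 \<omega>)) \<longleftrightarrow> V.law_invariant"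
    unfolding spherical_def V.law_invariant_def
    using borel_measurable_orthogonal_transformation push law by (metis (mono_tags, lifting))
  define lin where "lin \<alpha> x = sin \<alpha> * fst x + cos \<alpha> * snd x" for \<alpha> and x :: "real \<times> real"
  have lin_meas [measurable]: "lin \<alpha> \<in> borel_measurable borel" for \<alpha>
    unfolding lin_def by (intro borel_measurable_continuous_onI continuous_intros)
  have comb: "combination U\<^sub>1 U\<^sub>2 (sin \<alpha>) = (\<lambda>\<omega>. lin \<alpha> (U\<^sub>1 \<omega>, U\<^sub>2 \<omega>))" if "\<alpha> \<in> {0<..pi/2}" for \<alpha>
  proof -
    have "0 \<le> cos \<alpha>" using that by (intro cos_ge_zero) auto
    then show ?thesis by (simp add: combination_def[abs_def] lin_def cos_squared_eq[symmetric])
  qed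
  have comb1: "U\<^sub>1 = (\<lambda>\<omega>. lin (pi/2) (U\<^sub>1 \<omega>, U\<^sub>2 \<omega>))" by (simp add: lin_def)
  have tail: "measure N {\<omega> \<in> space N. lin \<alpha> (U\<^sub>1 \<omega>, U\<^sub>2 \<omega>) > u} = V.directional_tail \<alpha> u" for \<alpha> u
  proof -
    have "measure N {\<omega> \<in> space N. lin \<alpha> (U\<^sub>1 \<omega>, U\<^sub>2 \<omega>) > u} = measure (distr N borel (\<lambda>\<omega>. lin \<alpha> (U\<^sub>1 \<omega>, U\<^sub>2 \<omega>))) {u<..}"
      by (subst measure_distr) (auto intro!: arg_cong[where f="measure N"])
    also have "\<dots> = measure (distr V.law borel (lin \<alpha>)) {u<..}" by (simp add: push)
    also have "\<dots> = V.directional_tail \<alpha> u"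
      by (subst measure_distr) (auto simp: V.directional_tail_def lin_def vimage_def)
    finally show ?thesis .
  qed
  have sin_range: "(\<forall>\<rho>\<in>{0<..<1}. P \<rho>) \<longleftrightarrow> (\<forall>\<alpha>\<in>{0<..<pi/2}. P (sin \<alpha>))" for P :: "real \<Rightarrow> bool"
  proof -
    have "sin ` {0<..<pi/2} = {0<..<1::real}"
    proof (intro set_eqI iffI)
      fix \<rho> :: real assume "\<rho> \<in> {0<..<1}"
      then have "arcsin 0 < arcsin \<rho>" "arcsin \<rho> < arcsin 1" "sin (arcsin \<rho>) = \<rho>"
        by (auto intro!: arcsin_less_arcsin simp del: arcsin_0 arcsin_1)
      then have "\<rho> = sin (arcsin \<rho>)" "arcsin \<rho> \<in> {0<..<pi/2}" by simp_all
      then show "\<rho> \<in> sin ` {0<..<pi/2}" by (rule image_eqI)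
    next
      fix \<rho> :: real assume "\<rho> \<in> sin ` {0<..<pi/2}"
      then obtain \<alpha> where "\<rho> = sin \<alpha>" "0 < \<alpha>" "\<alpha> < pi / 2" by auto
      then show "\<rho> \<in> {0<..<1}"
        using sin_monotone_2pi[of \<alpha> "pi/2"] by (auto intro: sin_gt_zero)
    qed
    then show ?thesis by (metis (no_types, lifting) image_iff)
  qed
  have tail_comb: "(\<lambda>u. measure N {\<omega> \<in> space N. combination U\<^sub>1 U\<^sub>2 (sin \<alpha>) \<omega> > u}) = V.directional_tail \<alpha>"
    if "\<alpha> \<in> {0<..<pi/2}" for \<alpha>
    using that by (simp add: comb tail fun_eq_iff)
  have tail_U1: "(\<lambda>u. measure N {\<omega> \<in> space N. U\<^sub>1 \<omega> > u}) = V.directional_tail (pi/2)"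
    by (subst comb1) (simp add: tail)
  have tails: "(\<forall>\<rho>\<in>{0<..<1}.
             tail_equiv ?r
               (\<lambda>u. measure N {\<omega> \<in> space N. combination U\<^sub>1 U\<^sub>2 \<rho> \<omega> > u})
               (\<lambda>u. measure N {\<omega> \<in> space N. U\<^sub>1 \<omega> > u}))
          \<longleftrightarrow> spherical N (\<lambda>\<omega>. (U\<^sub>1 \<omega>, U\<^sub>2 \<omega>))" (is "?tails \<longleftrightarrow> ?sph")
  proof -
    have "?tails \<longleftrightarrow> (\<forall>\<alpha>\<in>{0<..<pi/2}. tail_equiv ?r (V.directional_tail \<alpha>) (V.directional_tail (pi/2)))"
      unfolding sin_range tail_U1 by (simp add: tail_comb)
    also have "\<dots> \<longleftrightarrow> V.law_invariant"
      using V.law_invariant_of_tail_equiv V.tail_equiv_of_invariant unfolding r by blast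
    finally show ?thesis by (simp add: spherical_iff)
  qed
  have densities: "(\<forall>\<rho>\<in>{0<..<1}. density_tail_equiv ?r (h \<rho>) (h 1)) \<longleftrightarrow> ?sph"
    if h: "\<forall>\<rho>\<in>{0<..<1}. has_real_density N (combination U\<^sub>1 U\<^sub>2 \<rho>) (h \<rho>)" and h1: "has_real_density N U\<^sub>1 (h 1)"
    for h :: "real \<Rightarrow> real \<Rightarrow> real"
  proof
    assume de: "\<forall>\<rho>\<in>{0<..<1}. density_tail_equiv ?r (h \<rho>) (h 1)"
    have "?tails"
    proof
      fix \<rho> :: real assume \<rho>: "\<rho> \<in> {0<..<1}"
      show "tail_equiv ?r
               (\<lambda>u. measure N {\<omega> \<in> space N. combination U\<^sub>1 U\<^sub>2 \<rho> \<omega> > u})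
               (\<lambda>u. measure N {\<omega> \<in> space N. U\<^sub>1 \<omega> > u})"
      proof (rule tail_equiv_of_density_tail_equiv[OF assms(2) h[rule_format, OF \<rho>] h1 de[rule_format, OF \<rho>] assms(16)])
        fix v assume "?r = ereal v"
        then have z: "V.directional_tail \<alpha> v = 0" for \<alpha>
          by (intro V.directional_tail_zero_beyond) (simp add: r)
        have "\<forall>\<rho>\<in>{0<..<1}. measure N {\<omega> \<in> space N. v < combination U\<^sub>1 U\<^sub>2 \<rho> \<omega>} = 0"
          unfolding sin_range using tail_comb z by (metis (no_types, lifting))
        then show "measure N {\<omega> \<in> space N. v < combination U\<^sub>1 U\<^sub>2 \<rho> \<omega>} = 0" using \<rho> by blast
        show "measure N {\<omega> \<in> space N. v < U\<^sub>1 \<omega>} = 0" using fun_cong[OF tail_U1, of v] z by simp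
      qed
    qed
    then show ?sph using tails by blast
  next
    assume ?sph
    then have inv: V.law_invariant by (simp add: spherical_iff)
    have lawU1: "distr N borel U\<^sub>1 = distr V.law borel fst"
      using push[OF lin_meas[of "pi/2"]] by (simp add: lin_def[abs_def])
    have "distr N lborel U\<^sub>1 = density lborel (\<lambda>x. ennreal (h 1 x))" and nonneg: "\<And>x. 0 \<le> h 1 x"
      using h1 by (auto simp: has_real_density_def distributed_def)
    moreover have "distr N lborel U\<^sub>1 = distr N borel U\<^sub>1" by (rule distr_cong) auto
    ultimately have "distr V.law borel fst = density lborel (\<lambda>x. ennreal (h 1 x))" using lawU1 by simp
    moreover have "h 1 \<in> borel_measurable borel"
      using h1 by (rule borel_measurable_has_real_density)
    ultimately have pos: "AE x in lborel. 0 < x \<and> ereal x < ?r \<longrightarrow> 0 < h 1 x"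
      using V.AE_first_density_pos[of "h 1"] inv nonneg unfolding r by blast
    have "density_tail_equiv ?r (h (sin \<alpha>)) (h 1)" if \<alpha>: "\<alpha> \<in> {0<..<pi/2}" for \<alpha>
      unfolding density_tail_equiv_def
    proof (rule tendsto_eventually)
      have "has_real_density N (combination U\<^sub>1 U\<^sub>2 (sin \<alpha>)) (h (sin \<alpha>))"
        using h \<alpha> unfolding sin_range by blast
      moreover have "distr N borel (combination U\<^sub>1 U\<^sub>2 (sin \<alpha>)) = distr N borel U\<^sub>1"
        using \<alpha> inv V.distr_law_direction[of \<alpha>] lawU1
        by (simp add: comb push V.law_invariant_def) (simp add: lin_def[abs_def])
      ultimately have "AE x in lborel. h (sin \<alpha>) x = h 1 x"
        using h1 by (intro has_real_density_unique_AE)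
      with pos have "AE x in lborel. 0 < x \<and> ereal x < ?r \<longrightarrow> h (sin \<alpha>) x / h 1 x = 1"
        by eventually_elim auto
      moreover note V.eventually_in_range[unfolded r]
      ultimately show "\<forall>\<^sub>F u in inf (increasing_to ?r) (ae_filter lborel). h (sin \<alpha>) u / h 1 u = 1"
        unfolding eventually_inf by blast
    qed
    then show "\<forall>\<rho>\<in>{0<..<1}. density_tail_equiv ?r (h \<rho>) (h 1)"
      unfolding sin_range by blast
  qed
  show ?thesis using tails densities by blast
qed

end
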